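(* Let $T>0$ and let $b,f:[0,T]\times\mathbb{R}\times\mathbb{R}\times\mathbb{R}\to\mathbb{R}$, $\phi:\mathbb{R}\to\mathbb{R}$ be deterministic measurable functions satisfying, with constants $\Lambda,K,K_0\ge0$, $\beta\in(0,1)$ and a locally bounded increasing $\ell\in L^1_{\mathrm{loc}}(\mathbb{R},\mathbb{R}_+)$, for all arguments: $|b(t,x,y,z)|\le\Lambda(1+|y|)$, $|b(t,x,y,z)-b(t,x,y',z')|\le K(|y-y'|+|z-z'|)$, $|f(t,x,y,z)|\le\Lambda(1+|y|+\ell(y)|z|^2)$, $|f(t,x,y,z)-f(t,x,y',z')|\le K(1+\ell(|y-y'|^2)(|z|+|z'|))(|y-y'|+|z-z'|)$, $|\phi(x)|\le\Lambda$, $|\phi(x)-\phi(x')|\le K_0|x-x'|^\beta$. Let $(X^x,Y^x,Z^x)$ be the strong solution of $$X_t=x+\int_0^tb(r,X_r,Y_r,Z_r)dr+W_t,\qquad Y_t=\phi(X_T)+\int_t^Tf(r,X_r,Y_r,Z_r)dr-\int_t^TZ_r\,dW_r.$$ Then the finite dimensional laws of $X^x$ are absolutely continuous with respect to Lebesgue measure; in particular, for fixed $t\in(0,T]$ the law of $X^x_t$ has a density with respect to Lebesgue measure.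
   Context: $W$ is a one-dimensional Brownian motion with augmented natural filtration. Equivalently, $X^x$ is the strong solution of $X_t=x+\int_0^t\tilde b(r,X_r)dr+W_t$ with $\tilde b(t,x)=b(t,x,v(t,x),\partial_xv(t,x))$, where $v$ is the decoupling field solving $\partial_tv+\frac12\partial_{xx}v+b(t,x,v,\partial_xv)\partial_xv+f(t,x,v,\partial_xv)=0$, $v(T,\cdot)=\phi$, with $Y_t=v(t,X_t)$, $Z_t=\partial_xv(t,X_t)$. *)

theory Defs
  imports "HOL-Probability.Probability"
begin

definition null_subsets :: "'a measure \<Rightarrow> 'a set set" where
  "null_subsets M = {A. \<exists>N\<in>null_sets M. A \<subseteq> N}"

definition complete_space_measure :: "'a measure \<Rightarrow> bool" where
  "complete_space_measure M \<longleftrightarrow> null_subsets M \<subseteq> sets M"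

definition natural_sets :: "'a measure \<Rightarrow> (real \<Rightarrow> 'a \<Rightarrow> real) \<Rightarrow> real \<Rightarrow> 'a set set" where
  "natural_sets M W t = (\<Union>s\<in>{0..t}. {W s -` B \<inter> space M | B. B \<in> sets borel})"

definition aug_nat_filtration :: "'a measure \<Rightarrow> (real \<Rightarrow> 'a \<Rightarrow> real) \<Rightarrow> real \<Rightarrow> 'a measure" where
  "aug_nat_filtration M W t = sigma (space M) (natural_sets M W t \<union> null_subsets M)"

definition brownian_motion :: "'a measure \<Rightarrow> (real \<Rightarrow> 'a \<Rightarrow> real) \<Rightarrow> bool" where
  "brownian_motion M W \<longleftrightarrow> prob_space M \<and>
     (\<forall>t\<ge>0. W t \<in> borel_measurable M) \<and>
     (\<forall>\<omega>\<in>space M. W 0 \<omega> = 0 \<and> continuous_on {0..} (\<lambda>t. W t \<omega>)) \<and>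
     (\<forall>s t. 0 \<le> s \<and> s < t \<longrightarrow>
        distributed M lborel (\<lambda>\<omega>. W t \<omega> - W s \<omega>) (normal_density 0 (sqrt (t - s))) \<and>
        prob_space.indep_set M (sigma_sets (space M) (natural_sets M W s))
          (sigma_sets (space M) {(\<lambda>\<omega>. W t \<omega> - W s \<omega>) -` B \<inter> space M | B. B \<in> sets borel}))"

definition progressive :: "(real \<Rightarrow> 'a measure) \<Rightarrow> real \<Rightarrow> (real \<Rightarrow> 'a \<Rightarrow> real) \<Rightarrow> bool" where
  "progressive F T Z \<longleftrightarrow>
     (\<forall>t\<in>{0..T}. (\<lambda>(s,\<omega>). Z s \<omega>) \<in> borel_measurable (restrict_space borel {0..t} \<Otimes>\<^sub>M F t))"

definition simple_integrand ::
  "'a measure \<Rightarrow> (real \<Rightarrow> 'a measure) \<Rightarrow> real \<Rightarrow> (nat \<Rightarrow> real) \<Rightarrow> nat \<Rightarrow> (nat \<Rightarrow> 'a \<Rightarrow> real) \<Rightarrow> bool" where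
  "simple_integrand M F T ts k \<xi> \<longleftrightarrow> ts 0 = 0 \<and> ts k = T \<and> (\<forall>i<k. ts i < ts (Suc i)) \<and>
     (\<forall>i<k. \<xi> i \<in> borel_measurable (F (ts i)) \<and> (\<exists>C. \<forall>\<omega>\<in>space M. \<bar>\<xi> i \<omega>\<bar> \<le> C))"

definition simple_process :: "(nat \<Rightarrow> real) \<Rightarrow> nat \<Rightarrow> (nat \<Rightarrow> 'a \<Rightarrow> real) \<Rightarrow> real \<Rightarrow> 'a \<Rightarrow> real" where
  "simple_process ts k \<xi> t \<omega> = (\<Sum>i<k. if ts i < t \<and> t \<le> ts (Suc i) then \<xi> i \<omega> else 0)"

definition simple_stoch_int ::
  "(real \<Rightarrow> 'a \<Rightarrow> real) \<Rightarrow> (nat \<Rightarrow> real) \<Rightarrow> nat \<Rightarrow> (nat \<Rightarrow> 'a \<Rightarrow> real) \<Rightarrow> real \<Rightarrow> 'a \<Rightarrow> real" where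
  "simple_stoch_int W ts k \<xi> t \<omega> =
     (\<Sum>i<k. \<xi> i \<omega> * (W (min t (ts (Suc i))) \<omega> - W (min t (ts i)) \<omega>))"

text \<open>Convergence to 0 in (outer) probability of nonnegative extended-real random quantities.\<close>
definition prob_to_zero :: "'a measure \<Rightarrow> (nat \<Rightarrow> 'a \<Rightarrow> ennreal) \<Rightarrow> bool" where
  "prob_to_zero M U \<longleftrightarrow> (\<forall>e>0. \<exists>A. (\<forall>n. A n \<in> sets M \<and>
       {\<omega>\<in>space M. U n \<omega> > ennreal e} \<subseteq> A n) \<and> (\<lambda>n. measure M (A n)) \<longlonglongrightarrow> 0)"

text \<open>I is (a continuous adapted version of) the Ito integral t \<mapsto> int_0^t Z dW on [0,T]:
  limit, uniformly on [0,T] in probability, of elementary integrals of any simple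
  integrands approximating Z in the sense int_0^T |H_n - Z|^2 dt \<rightarrow> 0 in probability.\<close>
definition ito_integral ::
  "'a measure \<Rightarrow> (real \<Rightarrow> 'a \<Rightarrow> real) \<Rightarrow> (real \<Rightarrow> 'a measure) \<Rightarrow> real \<Rightarrow>
   (real \<Rightarrow> 'a \<Rightarrow> real) \<Rightarrow> (real \<Rightarrow> 'a \<Rightarrow> real) \<Rightarrow> bool" where
  "ito_integral M W F T Z I \<longleftrightarrow>
     (\<forall>\<omega>\<in>space M. continuous_on {0..T} (\<lambda>t. I t \<omega>)) \<and>
     (\<forall>t\<in>{0..T}. I t \<in> borel_measurable (F t)) \<and>
     (\<forall>ts k \<xi>. (\<forall>n. simple_integrand M F T (ts n) (k n) (\<xi> n)) \<and>
        prob_to_zero M (\<lambda>n \<omega>. \<integral>\<^sup>+ s\<in>{0..T}. ennreal ((simple_process (ts n) (k n) (\<xi> n) s \<omega> - Z s \<omega>)\<^sup>2) \<partial>lborel)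
        \<longrightarrow> prob_to_zero M (\<lambda>n \<omega>. SUP t\<in>{0..T}. ennreal \<bar>simple_stoch_int W (ts n) (k n) (\<xi> n) t \<omega> - I t \<omega>\<bar>))"

definition fbsde_solution ::
  "'a measure \<Rightarrow> (real \<Rightarrow> 'a \<Rightarrow> real) \<Rightarrow> (real \<Rightarrow> 'a measure) \<Rightarrow> real \<Rightarrow>
   (real \<Rightarrow> real \<Rightarrow> real \<Rightarrow> real \<Rightarrow> real) \<Rightarrow> (real \<Rightarrow> real \<Rightarrow> real \<Rightarrow> real \<Rightarrow> real) \<Rightarrow>
   (real \<Rightarrow> real) \<Rightarrow> real \<Rightarrow> (real \<Rightarrow> 'a \<Rightarrow> real) \<Rightarrow> (real \<Rightarrow> 'a \<Rightarrow> real) \<Rightarrow>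
   (real \<Rightarrow> 'a \<Rightarrow> real) \<Rightarrow> bool" where
  "fbsde_solution M W F T b f \<phi> x X Y Z \<longleftrightarrow>
     (\<forall>\<omega>\<in>space M. continuous_on {0..T} (\<lambda>t. X t \<omega>) \<and> continuous_on {0..T} (\<lambda>t. Y t \<omega>)) \<and>
     (\<forall>t\<in>{0..T}. X t \<in> borel_measurable (F t) \<and> Y t \<in> borel_measurable (F t)) \<and>
     progressive F T Z \<and>
     (\<exists>C. \<forall>t\<in>{0..T}. \<forall>\<omega>\<in>space M. \<bar>Y t \<omega>\<bar> \<le> C) \<and>
     (\<integral>\<^sup>+ \<omega>. (\<integral>\<^sup>+ s\<in>{0..T}. ennreal ((Z s \<omega>)\<^sup>2) \<partial>lborel) \<partial>M) < \<infinity> \<and>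
     (\<exists>I. ito_integral M W F T Z I \<and>
        (AE \<omega> in M. \<forall>t\<in>{0..T}.
           set_integrable lborel {0..t} (\<lambda>r. b r (X r \<omega>) (Y r \<omega>) (Z r \<omega>)) \<and>
           X t \<omega> = x + (LINT r:{0..t}|lborel. b r (X r \<omega>) (Y r \<omega>) (Z r \<omega>)) + W t \<omega> \<and>
           set_integrable lborel {t..T} (\<lambda>r. f r (X r \<omega>) (Y r \<omega>) (Z r \<omega>)) \<and>
           Y t \<omega> = \<phi> (X T \<omega>) + (LINT r:{t..T}|lborel. f r (X r \<omega>) (Y r \<omega>) (Z r \<omega>))
                    - (I T \<omega> - I t \<omega>)))"

end

theory Submission
  imports Defs
begin

text \<open>
  Since \<open>Y\<close> is bounded and \<open>b\<close> has linear growth in \<open>y\<close>, the process \<open>D = X - x - W\<close> is adapted and almost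
  surely Lipschitz in time with a deterministic constant \<open>C\<close>; nothing else about the equation matters.
  In place of Girsanov's theorem, sample at mesh \<open>\<delta>\<close> and delay the drift by one step, so that
  \<open>X\<close> becomes a walk with increments \<open>d k + w k\<close>, where \<open>d k\<close> is known at time \<open>k \<delta>\<close>,
  \<open>\<bar>d k\<bar> \<le> C \<delta>\<close>, and \<open>w k\<close> is an independent centred Gaussian of variance \<open>\<delta>\<close>. Shifting such a
  Gaussian by \<open>d\<close> costs, by Cauchy-Schwarz, \<open>E g(d + w) \<le> exp(d\<^sup>2 / (2 \<delta>)) sqrt (E g(w)\<^sup>2)\<close>;
  iterating over \<open>T / \<delta>\<close> steps gives the factor \<open>exp (C\<^sup>2 T / 2)\<close>, uniformly in the mesh. Letting
  the mesh tend to \<open>0\<close> yields \<open>P (X \<in> U) \<le> exp (C\<^sup>2 T / 2) sqrt (P (x + W \<in> U))\<close> for the open sets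
  \<open>U\<close> of any countable family of marginals, hence, by outer regularity, absolute continuity with
  respect to the law of \<open>x + W\<close>, whose marginals are absolutely continuous.
\<close>

section \<open>Gaussian shifts and their cost\<close>

lemma normal_density_shift:
  assumes "\<sigma> > 0"
  shows "normal_density 0 \<sigma> (u - d) = normal_density 0 \<sigma> u * exp (d * u / \<sigma>\<^sup>2 - d\<^sup>2 / (2 * \<sigma>\<^sup>2))"
proof -
  have "- (u - d)\<^sup>2 / (2 * \<sigma>\<^sup>2) = - u\<^sup>2 / (2 * \<sigma>\<^sup>2) + (d * u / \<sigma>\<^sup>2 - d\<^sup>2 / (2 * \<sigma>\<^sup>2))"
    using assms by (simp add: field_simps power2_eq_square)
  then show ?thesis
    unfolding normal_density_def by (simp only: exp_add diff_0_right mult.assoc)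
qed

text \<open>The exponential is the density of the Gaussian shifted by \<open>d\<close> relative to
  the centred one. Completing the square turns its square times the centred density into
  \<open>exp (d\<^sup>2 / \<sigma>\<^sup>2)\<close> times the density centred at
  \<open>2 * d\<close>, which has mass one.\<close>

lemma normal_exp_moment:
  assumes \<sigma>: "\<sigma> > 0"
  shows "(\<integral>\<^sup>+ u. ennreal (exp (d * u / \<sigma>\<^sup>2 - d\<^sup>2 / (2 * \<sigma>\<^sup>2)))^2 \<partial>density lborel (normal_density 0 \<sigma>))
    = ennreal (exp (d\<^sup>2 / \<sigma>\<^sup>2))"
proof -
  have "(\<integral>\<^sup>+ u. ennreal (exp (d * u / \<sigma>\<^sup>2 - d\<^sup>2 / (2 * \<sigma>\<^sup>2)))^2 \<partial>density lborel (normal_density 0 \<sigma>))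
    = (\<integral>\<^sup>+ u. ennreal (normal_density 0 \<sigma> u) * ennreal (exp (d * u / \<sigma>\<^sup>2 - d\<^sup>2 / (2 * \<sigma>\<^sup>2)))^2 \<partial>lborel)"
    by (subst nn_integral_density) auto
  also have "\<dots> = (\<integral>\<^sup>+ u. ennreal (exp (d\<^sup>2 / \<sigma>\<^sup>2)) * ennreal (normal_density (2 * d) \<sigma> u) \<partial>lborel)"
  proof (intro nn_integral_cong)
    fix u
    have "normal_density (2 * d) \<sigma> u = normal_density 0 \<sigma> (u - 2 * d)"
      by (simp add: normal_density_def)
    also have "\<dots> = normal_density 0 \<sigma> u * exp (2 * d * u / \<sigma>\<^sup>2 - (2 * d)\<^sup>2 / (2 * \<sigma>\<^sup>2))"
      by (rule normal_density_shift[OF \<sigma>])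
    finally have "exp (d\<^sup>2 / \<sigma>\<^sup>2) * normal_density (2 * d) \<sigma> u
      = normal_density 0 \<sigma> u * (exp (d\<^sup>2 / \<sigma>\<^sup>2) * exp (2 * d * u / \<sigma>\<^sup>2 - (2 * d)\<^sup>2 / (2 * \<sigma>\<^sup>2)))"
      by simp
    also have "exp (d\<^sup>2 / \<sigma>\<^sup>2) * exp (2 * d * u / \<sigma>\<^sup>2 - (2 * d)\<^sup>2 / (2 * \<sigma>\<^sup>2))
      = (exp (d * u / \<sigma>\<^sup>2 - d\<^sup>2 / (2 * \<sigma>\<^sup>2)))^2"
      using \<sigma> by (simp add: exp_add[symmetric] exp_double[symmetric] power2_eq_square field_simps)
    finally show "ennreal (normal_density 0 \<sigma> u) * ennreal (exp (d * u / \<sigma>\<^sup>2 - d\<^sup>2 / (2 * \<sigma>\<^sup>2)))^2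
      = ennreal (exp (d\<^sup>2 / \<sigma>\<^sup>2)) * ennreal (normal_density (2 * d) \<sigma> u)"
      by (simp add: ennreal_power ennreal_mult[symmetric])
  qed
  also have "\<dots> = ennreal (exp (d\<^sup>2 / \<sigma>\<^sup>2)) * emeasure (density lborel (normal_density (2 * d) \<sigma>)) UNIV"
    by (subst nn_integral_cmult) (auto simp: emeasure_density)
  also have "emeasure (density lborel (normal_density (2 * d) \<sigma>)) UNIV = 1"
    using prob_space.emeasure_space_1[OF prob_space_normal_density[OF \<sigma>, of "2 * d"]] by simp
  finally show ?thesis by simp
qed

text \<open>Translating the integration variable moves the shift from \<open>g\<close> into the
  Gaussian weight, and Cauchy-Schwarz separates \<open>g\<close> from that weight. The square of
  \<open>g\<close> stays under the integral on purpose: with it the estimate can be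
  iterated.\<close>

lemma normal_shift_bound:
  fixes g :: "real \<Rightarrow> real"
  assumes \<sigma>: "\<sigma> > 0" and [measurable]: "g \<in> borel_measurable borel"
    and g: "\<And>u. 0 \<le> g u" "\<And>u. g u \<le> 1"
  shows "(\<integral>u. g (d + u) \<partial>density lborel (normal_density 0 \<sigma>))
    \<le> exp (d\<^sup>2 / (2 * \<sigma>\<^sup>2)) * sqrt (\<integral>u. (g u)\<^sup>2 \<partial>density lborel (normal_density 0 \<sigma>))"
proof -
  define Q where "Q = density lborel (normal_density 0 \<sigma>)"
  interpret Q: prob_space Q unfolding Q_def by (rule prob_space_normal_density[OF \<sigma>])
  have setsQ[measurable_cong]: "sets Q = sets borel" by (simp add: Q_def)
  let ?r = "\<lambda>u. exp (d * u / \<sigma>\<^sup>2 - d\<^sup>2 / (2 * \<sigma>\<^sup>2))"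
  have g2: "(g u)\<^sup>2 \<le> 1" for u using g[of u] by (simp add: power_le_one)
  have i1: "integrable Q (\<lambda>u. g (d + u))"
    by (intro Q.integrable_const_bound[of _ 1]) (auto simp: g)
  have i2: "integrable Q (\<lambda>u. (g u)\<^sup>2)"
    by (intro Q.integrable_const_bound[of _ 1]) (auto simp: g2)
  have "ennreal (\<integral>u. g (d + u) \<partial>Q) = (\<integral>\<^sup>+ u. ennreal (g (d + u)) \<partial>Q)"
    by (intro nn_integral_eq_integral[symmetric] i1) (auto simp: g)
  also have "\<dots> = (\<integral>\<^sup>+ u. ennreal (normal_density 0 \<sigma> u) * ennreal (g (d + u)) \<partial>lborel)"
    unfolding Q_def by (subst nn_integral_density) auto
  also have "\<dots> = (\<integral>\<^sup>+ u. ennreal (normal_density 0 \<sigma> (u - d)) * ennreal (g u) \<partial>lborel)"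
    using nn_integral_real_affine[of "\<lambda>u. ennreal (normal_density 0 \<sigma> (u - d)) * ennreal (g u)" 1 d] by simp
  also have "\<dots> = (\<integral>\<^sup>+ u. ennreal (normal_density 0 \<sigma> u) * (ennreal (g u) * ennreal (?r u)) \<partial>lborel)"
    by (intro nn_integral_cong) (simp add: normal_density_shift[OF \<sigma>] ennreal_mult g ac_simps)
  also have "\<dots> = (\<integral>\<^sup>+ u. ennreal (g u) * ennreal (?r u) \<partial>Q)"
    unfolding Q_def by (subst nn_integral_density) auto
  finally have *: "ennreal (\<integral>u. g (d + u) \<partial>Q) = \<dots>" .
  have "ennreal ((\<integral>u. g (d + u) \<partial>Q)\<^sup>2) = (\<integral>\<^sup>+ u. ennreal (g u) * ennreal (?r u) \<partial>Q)\<^sup>2"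
    using * by (simp add: ennreal_power[symmetric] g)
  also have "\<dots> \<le> (\<integral>\<^sup>+ u. (ennreal (g u))\<^sup>2 \<partial>Q) * (\<integral>\<^sup>+ u. (ennreal (?r u))\<^sup>2 \<partial>Q)"
    by (intro Cauchy_Schwarz_nn_integral) auto
  also have "(\<integral>\<^sup>+ u. (ennreal (?r u))\<^sup>2 \<partial>Q) = ennreal (exp (d\<^sup>2 / \<sigma>\<^sup>2))"
    unfolding Q_def by (rule normal_exp_moment[OF \<sigma>])
  also have "(\<integral>\<^sup>+ u. (ennreal (g u))\<^sup>2 \<partial>Q) = ennreal (\<integral>u. (g u)\<^sup>2 \<partial>Q)"
    using nn_integral_eq_integral[OF i2] by (simp add: ennreal_power g)
  finally have "(\<integral>u. g (d + u) \<partial>Q)\<^sup>2 \<le> (\<integral>u. (g u)\<^sup>2 \<partial>Q) * exp (d\<^sup>2 / \<sigma>\<^sup>2)"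
    by (simp add: ennreal_mult[symmetric])
  also have "\<dots> = (exp (d\<^sup>2 / (2 * \<sigma>\<^sup>2)) * sqrt (\<integral>u. (g u)\<^sup>2 \<partial>Q))\<^sup>2"
    by (simp add: power_mult_distrib exp_double[symmetric])
  finally show ?thesis
    unfolding Q_def by (rule power2_le_imp_le) simp
qed

section \<open>Brownian motion relative to a filtration\<close>

text \<open>The filtration is left abstract: the estimates see it only through adaptedness and the
  independence of each increment from the past, so the augmentation by null sets can be dealt with
  separately.\<close>

locale filtered_bm = prob_space M
  for M :: "'a measure" +
  fixes F :: "real \<Rightarrow> 'a measure" and W :: "real \<Rightarrow> 'a \<Rightarrow> real"
  assumes space_F[simp]: "space (F t) = space M"
    and sets_F: "0 \<le> t \<Longrightarrow> sets (F t) \<subseteq> sets M"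
    and F_mono: "0 \<le> s \<Longrightarrow> s \<le> t \<Longrightarrow> sets (F s) \<subseteq> sets (F t)"
    and W_adapted: "0 \<le> t \<Longrightarrow> W t \<in> borel_measurable (F t)"
    and W_0: "\<omega> \<in> space M \<Longrightarrow> W 0 \<omega> = 0"
    and W_cont: "\<omega> \<in> space M \<Longrightarrow> continuous_on {0..} (\<lambda>t. W t \<omega>)"
    and W_incr: "0 \<le> s \<Longrightarrow> s < t \<Longrightarrow>
        distributed M lborel (\<lambda>\<omega>. W t \<omega> - W s \<omega>) (normal_density 0 (sqrt (t - s)))"
    and W_indep: "0 \<le> s \<Longrightarrow> s < t \<Longrightarrow> indep_set (sets (F s))
        (sigma_sets (space M) {(\<lambda>\<omega>. W t \<omega> - W s \<omega>) -` B \<inter> space M | B. B \<in> sets borel})"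
begin

lemma measurable_F: "0 \<le> t \<Longrightarrow> f \<in> measurable (F t) N \<Longrightarrow> f \<in> measurable M N"
  using sets_F[of t] by (auto simp: measurable_def)

lemma measurable_F_mono: "0 \<le> s \<Longrightarrow> s \<le> t \<Longrightarrow> f \<in> measurable (F s) N \<Longrightarrow> f \<in> measurable (F t) N"
  using F_mono[of s t] by (auto simp: measurable_def)

lemma W_measurable: "0 \<le> t \<Longrightarrow> W t \<in> borel_measurable M"
  using measurable_F W_adapted by blast

text \<open>Independence of \<open>F s\<close> from the increment gives equality on measurable
  rectangles, and for sigma-finite factors these determine the product measure.\<close>

lemma joint_distr:
  assumes s: "0 \<le> s" "s < t" and \<eta>: "\<eta> \<in> measurable (F s) N"
  shows "distr M (N \<Otimes>\<^sub>M borel) (\<lambda>\<omega>. (\<eta> \<omega>, W t \<omega> - W s \<omega>))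
    = distr M N \<eta> \<Otimes>\<^sub>M density lborel (normal_density 0 (sqrt (t - s)))"
proof -
  have [measurable]: "\<eta> \<in> measurable M N" "W t \<in> borel_measurable M" "W s \<in> borel_measurable M"
    using measurable_F[OF s(1) \<eta>] W_measurable s by auto
  define Q where "Q = density lborel (normal_density 0 (sqrt (t - s)))"
  interpret Q: prob_space Q unfolding Q_def by (rule prob_space_normal_density) (use s in simp)
  interpret D: prob_space "distr M N \<eta>" by (rule prob_space_distr) simp
  have Q: "Q = distr M borel (\<lambda>\<omega>. W t \<omega> - W s \<omega>)"
    unfolding Q_def distributed_distr_eq_density[OF W_incr[OF s], symmetric]
    by (intro distr_cong) auto
  have "distr M N \<eta> \<Otimes>\<^sub>M Q = distr M (N \<Otimes>\<^sub>M borel) (\<lambda>\<omega>. (\<eta> \<omega>, W t \<omega> - W s \<omega>))"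
  proof (rule pair_measure_eqI)
    show "sigma_finite_measure (distr M N \<eta>)" "sigma_finite_measure Q" by unfold_locales
    show "sets (distr M N \<eta> \<Otimes>\<^sub>M Q) = sets (distr M (N \<Otimes>\<^sub>M borel) (\<lambda>\<omega>. (\<eta> \<omega>, W t \<omega> - W s \<omega>)))"
      by (simp add: Q cong: sets_pair_measure_cong)
    fix A B assume "A \<in> sets (distr M N \<eta>)" "B \<in> sets Q"
    then have [measurable]: "A \<in> sets N" "B \<in> sets borel" by (auto simp: Q)
    have "prob ((\<eta> -` A \<inter> space M) \<inter> ((\<lambda>\<omega>. W t \<omega> - W s \<omega>) -` B \<inter> space M))
      = prob (\<eta> -` A \<inter> space M) * prob ((\<lambda>\<omega>. W t \<omega> - W s \<omega>) -` B \<inter> space M)"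
      using measurable_sets[OF \<eta>, of A] by (intro indep_setD[OF W_indep[OF s]]) (auto intro!: sigma_sets.Basic)
    moreover have "(\<lambda>\<omega>. (\<eta> \<omega>, W t \<omega> - W s \<omega>)) -` (A \<times> B) \<inter> space M
      = (\<eta> -` A \<inter> space M) \<inter> ((\<lambda>\<omega>. W t \<omega> - W s \<omega>) -` B \<inter> space M)"
      by auto
    ultimately show "emeasure (distr M N \<eta>) A * emeasure Q B
      = emeasure (distr M (N \<Otimes>\<^sub>M borel) (\<lambda>\<omega>. (\<eta> \<omega>, W t \<omega> - W s \<omega>))) (A \<times> B)"
      by (simp add: Q emeasure_distr emeasure_eq_measure ennreal_mult)
  qed
  then show ?thesis unfolding Q_def by simp
qed

text \<open>This takes the place of conditioning on \<open>F s\<close>: by Fubini for the product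
  law of \<open>joint_distr\<close>, the past \<open>\<eta>\<close> is frozen and the increment is
  integrated out against its Gaussian law.\<close>

lemma integral_increment:
  fixes \<Phi> :: "'b \<Rightarrow> real \<Rightarrow> real"
  assumes s: "0 \<le> s" "s < t" and \<eta>: "\<eta> \<in> measurable (F s) N"
    and [measurable]: "case_prod \<Phi> \<in> borel_measurable (N \<Otimes>\<^sub>M borel)"
    and bd: "\<And>v u. \<bar>\<Phi> v u\<bar> \<le> B"
  shows "(\<integral>\<omega>. \<Phi> (\<eta> \<omega>) (W t \<omega> - W s \<omega>) \<partial>M)
    = (\<integral>\<omega>. (\<integral>u. \<Phi> (\<eta> \<omega>) u \<partial>density lborel (normal_density 0 (sqrt (t - s)))) \<partial>M)"
proof -
  define Q where "Q = density lborel (normal_density 0 (sqrt (t - s)))"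
  interpret Q: prob_space Q unfolding Q_def by (rule prob_space_normal_density) (use s in simp)
  have setsQ[measurable_cong]: "sets Q = sets borel" by (simp add: Q_def)
  have [measurable]: "\<eta> \<in> measurable M N" "W t \<in> borel_measurable M" "W s \<in> borel_measurable M"
    using measurable_F[OF s(1) \<eta>] W_measurable s by auto
  interpret D: prob_space "distr M N \<eta>" by (rule prob_space_distr) simp
  interpret DQ: pair_prob_space "distr M N \<eta>" Q ..
  have "(\<integral>\<omega>. \<Phi> (\<eta> \<omega>) (W t \<omega> - W s \<omega>) \<partial>M)
    = (\<integral>p. case_prod \<Phi> p \<partial>distr M (N \<Otimes>\<^sub>M borel) (\<lambda>\<omega>. (\<eta> \<omega>, W t \<omega> - W s \<omega>)))"
    by (subst integral_distr) auto
  also have "\<dots> = (\<integral>p. case_prod \<Phi> p \<partial>(distr M N \<eta> \<Otimes>\<^sub>M Q))"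
    using joint_distr[OF s \<eta>] by (simp add: Q_def)
  also have "\<dots> = (\<integral>v. (\<integral>u. \<Phi> v u \<partial>Q) \<partial>distr M N \<eta>)"
  proof (rule DQ.integral_fst[symmetric])
    show "integrable (distr M N \<eta> \<Otimes>\<^sub>M Q) (case_prod \<Phi>)"
      by (rule DQ.integrable_const_bound[of _ B]) (auto simp: bd)
  qed
  also have "\<dots> = (\<integral>\<omega>. (\<integral>u. \<Phi> (\<eta> \<omega>) u \<partial>Q) \<partial>M)"
    by (subst integral_distr) auto
  finally show ?thesis unfolding Q_def .
qed

end

section \<open>The shift estimate for a drifted Gaussian walk\<close>

text \<open>Walks of every length live in one space of sequences, padded with zeros; updating
  coordinate \<open>N\<close> appends an increment.\<close>

lemma measurable_upd_seq:
  "(\<lambda>(v, u). v(N := u)) \<in> borel_measurable ((borel :: (nat \<Rightarrow> real) measure) \<Otimes>\<^sub>M borel)"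
proof (rule measurable_coordinatewise_then_product)
  fix i :: nat
  have "(\<lambda>p :: (nat \<Rightarrow> real) \<times> real. fst p i) \<in> borel_measurable (borel \<Otimes>\<^sub>M borel)"
    using measurable_compose[OF measurable_fst measurable_product_coordinates] .
  then show "(\<lambda>p. (case p of (v, u) \<Rightarrow> v(N := u)) i) \<in> borel_measurable ((borel :: (nat \<Rightarrow> real) measure) \<Otimes>\<^sub>M borel)"
    by (cases "i = N") (auto simp: case_prod_beta)
qed

context filtered_bm
begin

text \<open>Induction on the number of steps, the last increment being integrated out first. Its
  drift \<open>d N\<close> is known at time \<open>N * \<delta>\<close>, so there it is a fixed
  shift and costs one factor \<open>exp (C\<^sup>2 * \<delta> / 2)\<close>; the induction hypothesis
  then handles a function of the shorter walk.\<close>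

lemma discrete_girsanov:
  fixes h :: "(nat \<Rightarrow> real) \<Rightarrow> real" and d :: "nat \<Rightarrow> 'a \<Rightarrow> real" and \<delta> C :: real
  defines "w \<equiv> \<lambda>k \<omega>. W (real (Suc k) * \<delta>) \<omega> - W (real k * \<delta>) \<omega>"
  assumes \<delta>: "\<delta> > 0"
    and d: "\<And>k. d k \<in> borel_measurable (F (real k * \<delta>))"
    and dC: "\<And>k \<omega>. \<bar>d k \<omega>\<bar> \<le> C * \<delta>"
    and "h \<in> borel_measurable borel" "\<And>v. 0 \<le> h v" "\<And>v. h v \<le> 1"
  shows "(\<integral>\<omega>. h (\<lambda>i. if i < N then d i \<omega> + w i \<omega> else 0) \<partial>M)
    \<le> exp (real N * (C\<^sup>2 * \<delta> / 2)) * sqrt (\<integral>\<omega>. (h (\<lambda>i. if i < N then w i \<omega> else 0))\<^sup>2 \<partial>M)"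
  using assms(5-)
proof (induction N arbitrary: h)
  case 0
  then show ?case by (simp add: prob_space)
next
  case (Suc N)
  note [measurable] = Suc.prems(1)
  note h = Suc.prems(2,3)
  have h2: "(h v)\<^sup>2 \<le> 1" for v using h[of v] by (simp add: power_le_one)
  define Q where "Q = density lborel (normal_density 0 (sqrt \<delta>))"
  interpret Q: prob_space Q unfolding Q_def by (rule prob_space_normal_density) (use \<delta> in simp)
  have setsQ[measurable_cong]: "sets Q = sets borel" by (simp add: Q_def)
  let ?v = "\<lambda>\<omega> i. if i < N then d i \<omega> + w i \<omega> else 0"
  let ?z = "\<lambda>\<omega> i. if i < N then w i \<omega> else 0"
  \<comment> \<open>\<open>h'\<close> is the L2 norm of \<open>h\<close> in the last, driftless
    increment. Because of the root, the square of \<open>h'\<close> integrates back to the square of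
    \<open>h\<close> on the longer walk, which is how the right-hand side reproduces itself.\<close>
  define h' where "h' = (\<lambda>v. sqrt (\<integral>u. (h (v(N := u)))\<^sup>2 \<partial>Q))"
  have hm[measurable]: "(\<lambda>(v, u). h (v(N := u))) \<in> borel_measurable (borel \<Otimes>\<^sub>M borel)"
    using measurable_compose[OF measurable_upd_seq Suc.prems(1)] by (simp only: split_beta')
  have h'm[measurable]: "h' \<in> borel_measurable borel"
    unfolding h'_def by measurable
  have i2: "integrable Q (\<lambda>u. (h (v(N := u)))\<^sup>2)" for v
    using measurable_Pair2[OF hm, of v] by (intro Q.integrable_const_bound[of _ 1]) (auto simp: h2)
  have h'0: "0 \<le> h' v" for v by (simp add: h'_def)
  have h'1: "h' v \<le> 1" for v
    unfolding h'_def using Q.integral_le_const[OF i2[of v], of 1] h2 by simp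
  have w_F: "w i \<in> borel_measurable (F (real N * \<delta>))" if "i < N" for i
  proof -
    have *: "real (Suc i) * \<delta> \<le> real N * \<delta>" "real i * \<delta> \<le> real N * \<delta>"
      using that \<delta> by (auto intro!: mult_right_mono)
    have "W (real (Suc i) * \<delta>) \<in> borel_measurable (F (real N * \<delta>))"
      "W (real i * \<delta>) \<in> borel_measurable (F (real N * \<delta>))"
      using * \<delta> by (auto intro!: measurable_F_mono[OF _ _ W_adapted])
    then show ?thesis unfolding w_def by measurable
  qed
  have d_F: "d i \<in> borel_measurable (F (real N * \<delta>))" if "i \<le> N" for i
    using that \<delta> by (intro measurable_F_mono[OF _ _ d]) (auto intro!: mult_right_mono)
  have v_F: "?v \<in> borel_measurable (F (real N * \<delta>))"
  proof (rule measurable_coordinatewise_then_product)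
    show "(\<lambda>\<omega>. ?v \<omega> i) \<in> borel_measurable (F (real N * \<delta>))" for i
      using w_F d_F by (cases "i < N") auto
  qed
  have v0_F: "?z \<in> borel_measurable (F (real N * \<delta>))"
  proof (rule measurable_coordinatewise_then_product)
    show "(\<lambda>\<omega>. ?z \<omega> i) \<in> borel_measurable (F (real N * \<delta>))" for i
      using w_F by (cases "i < N") auto
  qed
  have N\<delta>: "0 \<le> real N * \<delta>" "real N * \<delta> < real (Suc N) * \<delta>" "real (Suc N) * \<delta> - real N * \<delta> = \<delta>"
    using \<delta> by (auto simp: field_simps)
  note v_M[measurable] = measurable_F[OF N\<delta>(1) v_F] measurable_F[OF N\<delta>(1) v0_F]
    measurable_F[OF N\<delta>(1) d_F[OF order_refl]]
  have "(\<integral>\<omega>. (h' (?z \<omega>))\<^sup>2 \<partial>M) = (\<integral>\<omega>. (\<integral>u. (h ((?z \<omega>)(N := u)))\<^sup>2 \<partial>Q) \<partial>M)"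
    unfolding h'_def by simp
  also have "\<dots> = (\<integral>\<omega>. (h ((?z \<omega>)(N := W (real (Suc N) * \<delta>) \<omega> - W (real N * \<delta>) \<omega>)))\<^sup>2 \<partial>M)"
    unfolding Q_def
    by (subst integral_increment[OF N\<delta>(1,2) v0_F, of "\<lambda>v u. (h (v(N := u)))\<^sup>2" 1, unfolded N\<delta>(3)])
      (auto simp: h2)
  also have "\<dots> = (\<integral>\<omega>. (h (\<lambda>i. if i < Suc N then w i \<omega> else 0))\<^sup>2 \<partial>M)"
  proof -
    have "(?z \<omega>)(N := W (real (Suc N) * \<delta>) \<omega> - W (real N * \<delta>) \<omega>)
      = (\<lambda>i. if i < Suc N then w i \<omega> else 0)" for \<omega>
      by (auto simp: w_def less_Suc_eq fun_eq_iff)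
    then show ?thesis by simp
  qed
  finally have IH_eq: "(\<integral>\<omega>. (h' (?z \<omega>))\<^sup>2 \<partial>M) = (\<integral>\<omega>. (h (\<lambda>i. if i < Suc N then w i \<omega> else 0))\<^sup>2 \<partial>M)" .
  \<comment> \<open>The drift \<open>d N\<close> travels with the past as the component
    \<open>c\<close>, so that it is frozen together with the walk.\<close>
  have "(\<integral>\<omega>. h (\<lambda>i. if i < Suc N then d i \<omega> + w i \<omega> else 0) \<partial>M)
    = (\<integral>\<omega>. (\<lambda>(v, c) u. h (v(N := c + u))) (?v \<omega>, d N \<omega>) (W (real (Suc N) * \<delta>) \<omega> - W (real N * \<delta>) \<omega>) \<partial>M)"
    by (intro Bochner_Integration.integral_cong refl) (auto simp: w_def less_Suc_eq fun_eq_iff intro!: arg_cong[of _ _ h])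
  also have "\<dots> = (\<integral>\<omega>. (\<integral>u. (\<lambda>(v, c) u. h (v(N := c + u))) (?v \<omega>, d N \<omega>) u
      \<partial>density lborel (normal_density 0 (sqrt (real (Suc N) * \<delta> - real N * \<delta>)))) \<partial>M)"
  proof (rule integral_increment[OF N\<delta>(1,2)])
    show "(\<lambda>\<omega>. (?v \<omega>, d N \<omega>)) \<in> measurable (F (real N * \<delta>)) (borel \<Otimes>\<^sub>M borel)"
      using v_F d_F by auto
    have "(\<lambda>x. (fst (fst x), snd (fst x) + snd x)) \<in>
      measurable (((borel :: (nat \<Rightarrow> real) measure) \<Otimes>\<^sub>M borel) \<Otimes>\<^sub>M borel) (borel \<Otimes>\<^sub>M (borel :: real measure))"
      by measurable
    from measurable_compose[OF this hm]
    show "(\<lambda>((v, c), u). h (v(N := c + u))) \<in> borel_measurable ((borel \<Otimes>\<^sub>M borel) \<Otimes>\<^sub>M borel)"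
      by (simp add: split_beta' del: fun_upd_apply)
    show "\<bar>(case v of (v, c) \<Rightarrow> \<lambda>u. h (v(N := c + u))) u\<bar> \<le> 1" for v u
      using h by (auto split: prod.split)
  qed
  also have "\<dots> = (\<integral>\<omega>. (\<integral>u. h ((?v \<omega>)(N := d N \<omega> + u)) \<partial>Q) \<partial>M)"
    unfolding N\<delta>(3) Q_def by simp
  also have "\<dots> \<le> (\<integral>\<omega>. exp (C\<^sup>2 * \<delta> / 2) * h' (?v \<omega>) \<partial>M)"
  proof (rule integral_mono)
    have [measurable]: "(\<lambda>(\<omega>, u). h ((?v \<omega>)(N := d N \<omega> + u))) \<in> borel_measurable (M \<Otimes>\<^sub>M Q)"
    proof -
      have "(\<lambda>x. (?v (fst x), d N (fst x) + snd x)) \<in> measurable (M \<Otimes>\<^sub>M Q) (borel \<Otimes>\<^sub>M (borel :: real measure))"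
        by measurable
      from measurable_compose[OF this hm] show ?thesis by (simp add: split_beta' del: fun_upd_apply)
    qed
    have m1: "(\<lambda>u. h (v(N := u))) \<in> borel_measurable borel" for v
      using measurable_Pair2[OF hm, of v] by simp
    have m2: "(\<lambda>u. h (v(N := c + u))) \<in> borel_measurable borel" for v c
      using measurable_compose[OF _ m1[of v], of "\<lambda>u. c + u" borel] by simp
    have iQ: "integrable Q (\<lambda>u. h (v(N := c + u)))" for v c
      using m2[of v c] by (intro Q.integrable_const_bound[of _ 1]) (auto simp: h setsQ cong: measurable_cong_sets)
    show "integrable M (\<lambda>\<omega>. \<integral>u. h ((?v \<omega>)(N := d N \<omega> + u)) \<partial>Q)"
    proof (rule integrable_const_bound[of _ 1])
      show "AE \<omega> in M. norm (\<integral>u. h ((?v \<omega>)(N := d N \<omega> + u)) \<partial>Q) \<le> 1"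
        by (intro AE_I2) (simp add: h Q.integral_le_const[OF iQ])
    qed measurable
    show "integrable M (\<lambda>\<omega>. exp (C\<^sup>2 * \<delta> / 2) * h' (?v \<omega>))"
      by (intro integrable_mult_right integrable_const_bound[of _ 1]) (auto simp: h'0 h'1)
    fix \<omega>
    have "(\<integral>u. h ((?v \<omega>)(N := d N \<omega> + u)) \<partial>Q)
      \<le> exp ((d N \<omega>)\<^sup>2 / (2 * (sqrt \<delta>)\<^sup>2)) * h' (?v \<omega>)"
      unfolding h'_def Q_def using \<delta> m1 by (intro normal_shift_bound) (auto simp: h)
    \<comment> \<open>A drift of at most \<open>C * \<delta>\<close> meets a variance of
      \<open>\<delta>\<close>, so the exponent is of order \<open>\<delta>\<close> and stays bounded
      when summed over about \<open>T / \<delta>\<close> steps.\<close>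
    also have "(d N \<omega>)\<^sup>2 / (2 * (sqrt \<delta>)\<^sup>2) \<le> C\<^sup>2 * \<delta> / 2"
    proof -
      have "(d N \<omega>)\<^sup>2 \<le> (C * \<delta>)\<^sup>2"
        using dC[of N \<omega>] by (metis abs_ge_zero power2_abs power_mono)
      then show ?thesis using \<delta> by (simp add: field_simps power2_eq_square)
    qed
    finally show "(\<integral>u. h ((?v \<omega>)(N := d N \<omega> + u)) \<partial>Q) \<le> exp (C\<^sup>2 * \<delta> / 2) * h' (?v \<omega>)"
      by (simp add: h'0 mult_right_mono)
  qed
  also have "\<dots> = exp (C\<^sup>2 * \<delta> / 2) * (\<integral>\<omega>. h' (?v \<omega>) \<partial>M)" by simp
  also have "\<dots> \<le> exp (C\<^sup>2 * \<delta> / 2) *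
      (exp (real N * (C\<^sup>2 * \<delta> / 2)) * sqrt (\<integral>\<omega>. (h' (?z \<omega>))\<^sup>2 \<partial>M))"
    using Suc.IH[OF h'm h'0 h'1] by (intro mult_left_mono) auto
  finally show ?case
    unfolding IH_eq by (simp add: exp_add[symmetric] mult.assoc[symmetric] distrib_right add_divide_distrib)
qed

end

section \<open>Approximation of open sets and of times\<close>

lemma tendsto_fun_iff:
  fixes f :: "'a \<Rightarrow> 'i \<Rightarrow> 'b :: topological_space"
  shows "(f \<longlongrightarrow> l) G \<longleftrightarrow> (\<forall>i. ((\<lambda>c. f c i) \<longlongrightarrow> l i) G)"
  using limitin_componentwise[of "\<lambda>_. euclidean" UNIV f l G]
  by (simp add: euclidean_product_topology)

text \<open>The distance to the closed complement is positive exactly on \<open>U\<close>. The whole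
  space is excluded because \<open>infdist\<close> to the empty set is \<open>0\<close> by
  convention, which would give the limit \<open>0\<close>.\<close>

lemma open_indicator_limit:
  fixes U :: "'b :: metric_space set"
  assumes U: "open U" "U \<noteq> UNIV"
  shows "(\<lambda>n. min 1 (real n * infdist y (- U))) \<longlonglongrightarrow> indicator U y"
proof (cases "y \<in> U")
  case True
  have "infdist y (- U) \<noteq> 0"
    using in_closed_iff_infdist_zero[of "- U" y] U True by auto
  then have pos: "0 < infdist y (- U)" using infdist_nonneg[of y "- U"] by linarith
  obtain m where m: "1 / infdist y (- U) \<le> real m" using real_arch_simple by blast
  have "min 1 (real n * infdist y (- U)) = 1" if "n \<ge> m" for n
  proof -
    have "1 / infdist y (- U) \<le> real n" using m that by linarith
    then show ?thesis using pos by (simp add: field_simps)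
  qed
  then have "eventually (\<lambda>n. min 1 (real n * infdist y (- U)) = 1) sequentially"
    unfolding eventually_sequentially by blast
  then show ?thesis using True by (simp add: tendsto_eventually)
qed simp

text \<open>Rounding down to the grid and stepping back \<open>c\<close> points moves a time by at
  most \<open>c + 1\<close> meshes, and truncation at zero only brings it closer to
  \<open>s\<close>. The cases \<open>c = 0\<close> and \<open>c = 1\<close> are the sampling times
  of \<open>W\<close> and of the drift.\<close>

lemma grid_tendsto:
  fixes s T :: real and c :: nat
  assumes T: "T > 0" and s: "0 \<le> s"
  shows "(\<lambda>n. real (nat \<lfloor>s / (T / real (Suc n))\<rfloor> - c) * (T / real (Suc n))) \<longlonglongrightarrow> s"
proof -
  have lim: "(\<lambda>n. a * (T / real (Suc n))) \<longlonglongrightarrow> 0" for a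
    using tendsto_mult_right_zero[OF LIMSEQ_inverse_real_of_nat, of "a * T"] by (simp add: field_simps)
  define \<delta> where "\<delta> n = T / real (Suc n)" for n
  have \<delta>: "\<delta> n > 0" for n using T by (simp add: \<delta>_def)
  have lower_lim: "(\<lambda>n. s - (real c + 1) * \<delta> n) \<longlonglongrightarrow> s - 0"
    unfolding \<delta>_def by (intro tendsto_diff tendsto_const lim)
  have lower: "s - (real c + 1) * \<delta> n \<le> real (nat \<lfloor>s / \<delta> n\<rfloor> - c) * \<delta> n" for n
  proof -
    have "s / \<delta> n - (real c + 1) \<le> real (nat \<lfloor>s / \<delta> n\<rfloor> - c)" by linarith
    then have "(s / \<delta> n - (real c + 1)) * \<delta> n \<le> real (nat \<lfloor>s / \<delta> n\<rfloor> - c) * \<delta> n"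
      using \<delta>[of n] by (intro mult_right_mono) auto
    then show ?thesis using \<delta>[of n] by (simp add: left_diff_distrib)
  qed
  have upper: "real (nat \<lfloor>s / \<delta> n\<rfloor> - c) * \<delta> n \<le> s" for n
  proof -
    have "0 \<le> s / \<delta> n" using \<delta>[of n] s by simp
    then have "real (nat \<lfloor>s / \<delta> n\<rfloor> - c) \<le> s / \<delta> n" by linarith
    then show ?thesis using \<delta>[of n] by (simp add: pos_le_divide_eq)
  qed
  show ?thesis
    unfolding \<delta>_def[symmetric]
  proof (rule tendsto_sandwich)
    show "(\<lambda>n. s - (real c + 1) * \<delta> n) \<longlonglongrightarrow> s" using lower_lim by simp
  qed (auto simp: lower upper)
qed

section \<open>Passage from the grid to continuous time\<close>

text \<open>\<open>D\<close> stands for the accumulated drift \<open>X - x - W\<close>. Adaptedness,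
  the start at \<open>0\<close> and a deterministic Lipschitz constant are all that is kept of the
  forward equation.\<close>

locale lipschitz_drift = filtered_bm M F W
  for M :: "'a measure" and F W +
  fixes D :: "real \<Rightarrow> 'a \<Rightarrow> real" and T C :: real
  assumes T_pos: "0 < T" and C_nonneg: "0 \<le> C"
    and D_adapted: "t \<in> {0..T} \<Longrightarrow> D t \<in> borel_measurable (F t)"
    and D_lip: "AE \<omega> in M. D 0 \<omega> = 0 \<and> (\<forall>s\<in>{0..T}. \<forall>t\<in>{0..T}. \<bar>D t \<omega> - D s \<omega>\<bar> \<le> C * \<bar>t - s\<bar>)"
begin

lemma D_measurable: "t \<in> {0..T} \<Longrightarrow> D t \<in> borel_measurable M"
  using measurable_F[OF _ D_adapted] by simp

text \<open>The drift is sampled one grid point behind \<open>W\<close>, so that the shift of each increment is known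
  before the increment; truncated subtraction makes \<open>k = 0\<close> read \<open>D 0\<close>.\<close>
lemma grid_bound:
  fixes g :: "(nat \<Rightarrow> real) \<Rightarrow> real" and t :: "nat \<Rightarrow> real" and n :: nat
  defines "\<delta> \<equiv> T / real (Suc n)"
  defines "k \<equiv> \<lambda>i. nat \<lfloor>t i / \<delta>\<rfloor>"
  assumes [measurable]: "g \<in> borel_measurable borel" and g: "\<And>v. 0 \<le> g v" "\<And>v. g v \<le> 1"
    and t: "\<And>i. t i \<in> {0..T}"
  shows "(\<integral>\<omega>. g (\<lambda>i. x + D (real (k i - 1) * \<delta>) \<omega> + W (real (k i) * \<delta>) \<omega>) \<partial>M)
    \<le> exp (C\<^sup>2 * T / 2) * sqrt (\<integral>\<omega>. (g (\<lambda>i. x + W (real (k i) * \<delta>) \<omega>))\<^sup>2 \<partial>M)"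
proof -
  have \<delta>: "\<delta> > 0" using T_pos by (simp add: \<delta>_def)
  have N\<delta>: "real (Suc n) * \<delta> = T" by (simp add: \<delta>_def)
  have grid: "real j * \<delta> \<in> {0..T}" if "j \<le> Suc n" for j
    using that \<delta> N\<delta> mult_right_mono[of "real j" "real (Suc n)" \<delta>] by auto
  have k: "k i \<le> Suc n" for i
  proof -
    have "t i / \<delta> \<le> real (Suc n)"
      using t[of i] \<delta> N\<delta> by (simp add: divide_le_eq)
    then show ?thesis unfolding k_def by linarith
  qed
  \<comment> \<open>The Lipschitz bound holds almost surely, while \<open>discrete_girsanov\<close>
    asks for a bound at every \<open>\<omega>\<close>; clipping provides it and changes nothing
    almost surely. At \<open>j = 0\<close> the difference is \<open>D 0 - D 0\<close>, and the zero
    beyond \<open>Suc n\<close> avoids times after \<open>T\<close>, where \<open>D\<close> is not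
    known to be adapted.\<close>
  define d where "d j \<omega> = (if j \<le> Suc n then
    max (- (C * \<delta>)) (min (C * \<delta>) (D (real j * \<delta>) \<omega> - D (real (j - 1) * \<delta>) \<omega>)) else 0)" for j \<omega>
  define w where "w j \<omega> = W (real (Suc j) * \<delta>) \<omega> - W (real j * \<delta>) \<omega>" for j \<omega>
  \<comment> \<open>Partial sums rebuild the grid values from the increments; since
    \<open>k i \<le> Suc n\<close>, cutting the walk at \<open>Suc n\<close> loses nothing.\<close>
  define h where "h a = g (\<lambda>i. x + (\<Sum>j<k i. a j))" for a
  have d_F: "d j \<in> borel_measurable (F (real j * \<delta>))" for j
  proof (cases "j \<le> Suc n")
    case True
    have [measurable]: "D (real j * \<delta>) \<in> borel_measurable (F (real j * \<delta>))"
      by (intro D_adapted grid True)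
    have "real (j - 1) * \<delta> \<le> real j * \<delta>" using \<delta> by (intro mult_right_mono) auto
    then have [measurable]: "D (real (j - 1) * \<delta>) \<in> borel_measurable (F (real j * \<delta>))"
      using True \<delta> by (intro measurable_F_mono[OF _ _ D_adapted[OF grid]]) auto
    have "d j = (\<lambda>\<omega>. max (- (C * \<delta>)) (min (C * \<delta>) (D (real j * \<delta>) \<omega> - D (real (j - 1) * \<delta>) \<omega>)))"
      using True by (simp add: d_def fun_eq_iff)
    then show ?thesis by (simp only:) measurable
  next
    case False
    then have "d j = (\<lambda>_. 0)" by (simp add: d_def fun_eq_iff)
    then show ?thesis by simp
  qed
  have d_bd: "\<bar>d j \<omega>\<bar> \<le> C * \<delta>" for j \<omega>
  proof -
    have "0 \<le> C * \<delta>" using C_nonneg \<delta> by simp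
    then show ?thesis unfolding d_def by (auto simp: max_def min_def)
  qed
  have shift_meas: "(\<lambda>a i. x + (\<Sum>j<k i. a j)) \<in> borel_measurable borel"
    by (intro measurable_coordinatewise_then_product borel_measurable_add borel_measurable_sum
        borel_measurable_const measurable_product_coordinates)
  have h_meas: "h \<in> borel_measurable borel"
    unfolding h_def using measurable_compose[OF shift_meas assms(3)] by simp
  have trunc: "h (\<lambda>i. if i < Suc n then a i else 0) = g (\<lambda>i. x + (\<Sum>j<k i. a j))" for a
  proof -
    have "(\<Sum>j<k i. if j < Suc n then a j else 0) = (\<Sum>j<k i. a j)" for i
      using k[of i] by (intro sum.cong) auto
    then show ?thesis unfolding h_def by simp
  qed
  have sum_w: "(\<Sum>j<m. w j \<omega>) = W (real m * \<delta>) \<omega>" if "\<omega> \<in> space M" for m \<omega>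
    unfolding w_def using sum_lessThan_telescope[of "\<lambda>j. W (real j * \<delta>) \<omega>" m] W_0[OF that] by simp
  \<comment> \<open>On a Lipschitz path the clipping is inactive and the sum telescopes. Each
    \<open>d j\<close> is the drift over the preceding cell, hence the index \<open>m - 1\<close>
    instead of \<open>m\<close>.\<close>
  have sum_d: "(\<Sum>j<m. d j \<omega>) = D (real (m - 1) * \<delta>) \<omega>"
    if "D 0 \<omega> = 0 \<and> (\<forall>s\<in>{0..T}. \<forall>t\<in>{0..T}. \<bar>D t \<omega> - D s \<omega>\<bar> \<le> C * \<bar>t - s\<bar>)" "m \<le> Suc n" for m \<omega>
    using that(2)
  proof (induction m)
    case 0 then show ?case using that(1) by simp
  next
    case (Suc m)
    have "\<bar>D (real m * \<delta>) \<omega> - D (real (m - 1) * \<delta>) \<omega>\<bar> \<le> C * \<bar>real m * \<delta> - real (m - 1) * \<delta>\<bar>"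
      using that(1) grid[of m] grid[of "m - 1"] Suc.prems by auto
    also have "\<bar>real m * \<delta> - real (m - 1) * \<delta>\<bar> \<le> \<delta>"
      using \<delta> by (cases m) (auto simp: field_simps)
    finally have "\<bar>D (real m * \<delta>) \<omega> - D (real (m - 1) * \<delta>) \<omega>\<bar> \<le> C * \<delta>"
      using C_nonneg by (simp add: mult_left_mono)
    then have "d m \<omega> = D (real m * \<delta>) \<omega> - D (real (m - 1) * \<delta>) \<omega>"
      using Suc.prems unfolding d_def by auto
    then show ?case using Suc by simp
  qed
  have "(\<integral>\<omega>. g (\<lambda>i. x + D (real (k i - 1) * \<delta>) \<omega> + W (real (k i) * \<delta>) \<omega>) \<partial>M)
    = (\<integral>\<omega>. h (\<lambda>i. if i < Suc n then d i \<omega> + w i \<omega> else 0) \<partial>M)"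
  proof (rule integral_cong_AE)
    have [measurable]: "D (real (k i - 1) * \<delta>) \<in> borel_measurable M" for i
      using k[of i] by (intro D_measurable grid) auto
    have [measurable]: "W (real (k i) * \<delta>) \<in> borel_measurable M" for i
      using \<delta> by (intro W_measurable) auto
    have "(\<lambda>\<omega> i. x + D (real (k i - 1) * \<delta>) \<omega> + W (real (k i) * \<delta>) \<omega>) \<in> borel_measurable M"
      by (intro measurable_coordinatewise_then_product) measurable
    then show "(\<lambda>\<omega>. g (\<lambda>i. x + D (real (k i - 1) * \<delta>) \<omega> + W (real (k i) * \<delta>) \<omega>)) \<in> borel_measurable M"
      using measurable_compose[OF _ assms(3)] by blast
    have [measurable]: "d i \<in> borel_measurable M" "w i \<in> borel_measurable M" for i
      using measurable_F[OF _ d_F] W_measurable \<delta> unfolding w_def by auto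
    have "(\<lambda>\<omega> i. if i < Suc n then d i \<omega> + w i \<omega> else 0) \<in> borel_measurable M"
      by (intro measurable_coordinatewise_then_product) measurable
    then show "(\<lambda>\<omega>. h (\<lambda>i. if i < Suc n then d i \<omega> + w i \<omega> else 0)) \<in> borel_measurable M"
      using measurable_compose[OF _ h_meas] by blast
    show "AE \<omega> in M. g (\<lambda>i. x + D (real (k i - 1) * \<delta>) \<omega> + W (real (k i) * \<delta>) \<omega>)
      = h (\<lambda>i. if i < Suc n then d i \<omega> + w i \<omega> else 0)"
      using D_lip AE_space
    proof eventually_elim
      case (elim \<omega>)
      show ?case unfolding trunc sum.distrib using sum_d[OF elim(1) k] sum_w[OF elim(2)]
        by (simp add: add.assoc)
    qed
  qed
  also have "\<dots> \<le> exp (real (Suc n) * (C\<^sup>2 * \<delta> / 2)) * sqrt (\<integral>\<omega>. (h (\<lambda>i. if i < Suc n then w i \<omega> else 0))\<^sup>2 \<partial>M)"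
    unfolding w_def
    by (rule discrete_girsanov[OF \<delta> d_F d_bd h_meas]) (auto simp: h_def g)
  finally have "(\<integral>\<omega>. g (\<lambda>i. x + D (real (k i - 1) * \<delta>) \<omega> + W (real (k i) * \<delta>) \<omega>) \<partial>M)
    \<le> exp (real (Suc n) * (C\<^sup>2 * \<delta> / 2)) * sqrt (\<integral>\<omega>. (h (\<lambda>i. if i < Suc n then w i \<omega> else 0))\<^sup>2 \<partial>M)" .
  \<comment> \<open>There are \<open>Suc n\<close> steps of mesh \<open>T / Suc n\<close>, so the
    constant does not depend on \<open>n\<close>.\<close>
  moreover have "real (Suc n) * (C\<^sup>2 * \<delta> / 2) = C\<^sup>2 * T / 2"
    unfolding N\<delta>[symmetric] by (simp add: field_simps)
  moreover have "(\<integral>\<omega>. (h (\<lambda>i. if i < Suc n then w i \<omega> else 0))\<^sup>2 \<partial>M)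
    = (\<integral>\<omega>. (g (\<lambda>i. x + W (real (k i) * \<delta>) \<omega>))\<^sup>2 \<partial>M)"
    by (intro Bochner_Integration.integral_cong refl) (simp only: trunc sum_w)
  ultimately show ?thesis by (simp only:)
qed

text \<open>The constant of \<open>grid_bound\<close> is free of the mesh, so both sides pass to the
  limit by dominated convergence, using continuity of \<open>W\<close>, of \<open>D\<close> on
  Lipschitz paths, and of \<open>g\<close> in the product topology.\<close>

lemma continuous_bound:
  fixes g :: "(nat \<Rightarrow> real) \<Rightarrow> real" and t :: "nat \<Rightarrow> real"
  assumes g_cont: "continuous_on UNIV g" and g: "\<And>v. 0 \<le> g v" "\<And>v. g v \<le> 1"
    and t: "\<And>i. t i \<in> {0..T}"
  shows "(\<integral>\<omega>. g (\<lambda>i. x + D (t i) \<omega> + W (t i) \<omega>) \<partial>M)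
    \<le> exp (C\<^sup>2 * T / 2) * sqrt (\<integral>\<omega>. (g (\<lambda>i. x + W (t i) \<omega>))\<^sup>2 \<partial>M)"
proof -
  have g_meas: "g \<in> borel_measurable borel"
    using g_cont by (rule borel_measurable_continuous_onI)
  \<comment> \<open>\<open>u 0\<close> gives the grid times at which \<open>W\<close> is read,
    \<open>u 1\<close> those for \<open>D\<close>, one point earlier where possible; both tend to
    \<open>t i\<close>.\<close>
  define u where "u c n i = real (nat \<lfloor>t i / (T / real (Suc n))\<rfloor> - c) * (T / real (Suc n))" for c n i
  have u_lim: "(\<lambda>n. u c n i) \<longlonglongrightarrow> t i" for c i
    unfolding u_def using T_pos t[of i] by (intro grid_tendsto) auto
  have u0: "0 \<le> u c n i" for c n i unfolding u_def using T_pos by simp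
  have uT: "u c n i \<in> {0..T}" for c n i
  proof -
    have "0 \<le> t i / (T / real (Suc n))" using t[of i] T_pos by simp
    then have "real (nat \<lfloor>t i / (T / real (Suc n))\<rfloor> - c) \<le> t i / (T / real (Suc n))" by linarith
    then have "u c n i \<le> t i / (T / real (Suc n)) * (T / real (Suc n))"
      unfolding u_def using T_pos by (intro mult_right_mono) auto
    then show ?thesis using t[of i] T_pos u0[of c n i] by simp
  qed
  have W_lim: "(\<lambda>n. W (u 0 n i) \<omega>) \<longlonglongrightarrow> W (t i) \<omega>" if "\<omega> \<in> space M" for \<omega> i
    using t[of i] u0 by (intro continuous_on_tendsto_compose[OF W_cont[OF that] u_lim]) auto
  have D_lim: "(\<lambda>n. D (u 1 n i) \<omega>) \<longlonglongrightarrow> D (t i) \<omega>"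
    if "\<forall>s\<in>{0..T}. \<forall>t\<in>{0..T}. \<bar>D t \<omega> - D s \<omega>\<bar> \<le> C * \<bar>t - s\<bar>" for \<omega> i
  proof (rule LIM_zero_cancel, rule Lim_null_comparison)
    show "eventually (\<lambda>n. norm (D (u 1 n i) \<omega> - D (t i) \<omega>) \<le> C * \<bar>u 1 n i - t i\<bar>) sequentially"
      using that uT t[of i] by auto
    show "(\<lambda>n. C * \<bar>u 1 n i - t i\<bar>) \<longlonglongrightarrow> 0"
      by (intro tendsto_mult_right_zero tendsto_rabs_zero LIM_zero u_lim)
  qed
  have g_lim: "(\<lambda>n. g (y n)) \<longlonglongrightarrow> g l" if "\<And>i. (\<lambda>n. y n i) \<longlonglongrightarrow> l i" for y l
    using that by (intro continuous_on_tendsto_compose[OF g_cont]) (auto simp: tendsto_fun_iff)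
  have W_m: "W s \<in> borel_measurable M" if "s \<in> {0..T}" for s using W_measurable that by simp
  have DW_meas: "(\<lambda>\<omega>. g (\<lambda>i. x + D (a i) \<omega> + W (c i) \<omega>)) \<in> borel_measurable M"
    if "\<And>i. a i \<in> {0..T}" "\<And>i. c i \<in> {0..T}" for a c
  proof -
    have [measurable]: "D (a i) \<in> borel_measurable M" "W (c i) \<in> borel_measurable M" for i
      using D_measurable W_m that by auto
    have "(\<lambda>\<omega> i. x + D (a i) \<omega> + W (c i) \<omega>) \<in> borel_measurable M"
      by (intro measurable_coordinatewise_then_product) measurable
    then show ?thesis using measurable_compose[OF _ g_meas] by blast
  qed
  have W_meas: "(\<lambda>\<omega>. g (\<lambda>i. x + W (c i) \<omega>)) \<in> borel_measurable M"
    if "\<And>i. c i \<in> {0..T}" for c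
  proof -
    have [measurable]: "W (c i) \<in> borel_measurable M" for i
      using W_m that by auto
    have "(\<lambda>\<omega> i. x + W (c i) \<omega>) \<in> borel_measurable M"
      by (intro measurable_coordinatewise_then_product) measurable
    then show ?thesis using measurable_compose[OF _ g_meas] by blast
  qed
  have lim1: "(\<lambda>n. \<integral>\<omega>. g (\<lambda>i. x + D (u 1 n i) \<omega> + W (u 0 n i) \<omega>) \<partial>M)
    \<longlonglongrightarrow> (\<integral>\<omega>. g (\<lambda>i. x + D (t i) \<omega> + W (t i) \<omega>) \<partial>M)"
  proof (rule integral_dominated_convergence[where w = "\<lambda>_. 1"])
    show "AE \<omega> in M. (\<lambda>n. g (\<lambda>i. x + D (u 1 n i) \<omega> + W (u 0 n i) \<omega>))
      \<longlonglongrightarrow> g (\<lambda>i. x + D (t i) \<omega> + W (t i) \<omega>)"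
      using D_lip AE_space
    proof eventually_elim
      case (elim \<omega>)
      show ?case
        by (rule g_lim, rule tendsto_add[OF tendsto_add[OF tendsto_const D_lim] W_lim[OF elim(2)]])
          (use elim(1) in blast)
    qed
  qed (use DW_meas t uT g in auto)
  have "(\<lambda>n. \<integral>\<omega>. (g (\<lambda>i. x + W (u 0 n i) \<omega>))\<^sup>2 \<partial>M)
    \<longlonglongrightarrow> (\<integral>\<omega>. (g (\<lambda>i. x + W (t i) \<omega>))\<^sup>2 \<partial>M)"
  proof (rule integral_dominated_convergence[where w = "\<lambda>_. 1"])
    show "AE \<omega> in M. (\<lambda>n. (g (\<lambda>i. x + W (u 0 n i) \<omega>))\<^sup>2) \<longlonglongrightarrow> (g (\<lambda>i. x + W (t i) \<omega>))\<^sup>2"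
      by (intro AE_I2 tendsto_power g_lim tendsto_add[OF tendsto_const W_lim])
  qed (use W_meas t uT g in \<open>auto simp: power_le_one\<close>)
  then have lim2: "(\<lambda>n. exp (C\<^sup>2 * T / 2) * sqrt (\<integral>\<omega>. (g (\<lambda>i. x + W (u 0 n i) \<omega>))\<^sup>2 \<partial>M))
    \<longlonglongrightarrow> exp (C\<^sup>2 * T / 2) * sqrt (\<integral>\<omega>. (g (\<lambda>i. x + W (t i) \<omega>))\<^sup>2 \<partial>M)"
    by (intro tendsto_intros)
  have bd: "(\<integral>\<omega>. g (\<lambda>i. x + D (u 1 n i) \<omega> + W (u 0 n i) \<omega>) \<partial>M)
    \<le> exp (C\<^sup>2 * T / 2) * sqrt (\<integral>\<omega>. (g (\<lambda>i. x + W (u 0 n i) \<omega>))\<^sup>2 \<partial>M)" for n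
    using grid_bound[OF g_meas g t, where x = x and n = n] by (simp add: u_def)
  show ?thesis using bd by (intro LIMSEQ_le[OF lim1 lim2] exI allI impI)
qed

text \<open>Continuous functions with values in \<open>[0, 1]\<close> converge to the indicator of
  \<open>U\<close>, and dominated convergence carries \<open>continuous_bound\<close> over to
  it.\<close>

lemma open_bound:
  fixes t :: "nat \<Rightarrow> real"
  assumes t: "\<And>i. t i \<in> {0..T}" and U: "open U"
  shows "measure (distr M borel (\<lambda>\<omega> i. x + D (t i) \<omega> + W (t i) \<omega>)) U
    \<le> exp (C\<^sup>2 * T / 2) * sqrt (measure (distr M borel (\<lambda>\<omega> i. x + W (t i) \<omega>)) U)"
proof (cases "U = UNIV")
  \<comment> \<open>Here the approximating functions would vanish identically; instead, both laws
    have mass one and the factor is at least one.\<close>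
  case True
  have [measurable]: "D (t i) \<in> borel_measurable M" "W (t i) \<in> borel_measurable M" for i
    using D_measurable[OF t] W_measurable t[of i] by auto
  have "(\<lambda>\<omega> i. x + D (t i) \<omega> + W (t i) \<omega>) \<in> borel_measurable M" "(\<lambda>\<omega> i. x + W (t i) \<omega>) \<in> borel_measurable M"
    by (intro measurable_coordinatewise_then_product; measurable)+
  then show ?thesis using True C_nonneg T_pos by (simp add: measure_distr prob_space)
next
  case False
  have [measurable]: "D (t i) \<in> borel_measurable M" "W (t i) \<in> borel_measurable M" for i
    using D_measurable[OF t] W_measurable t[of i] by auto
  let ?X = "\<lambda>\<omega> i. x + D (t i) \<omega> + W (t i) \<omega>" and ?B = "\<lambda>\<omega> i. x + W (t i) \<omega>"
  have X[measurable]: "?X \<in> borel_measurable M" and B[measurable]: "?B \<in> borel_measurable M"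
    by (intro measurable_coordinatewise_then_product; measurable)+
  have [measurable]: "U \<in> sets borel" using U by simp
  define g where "g n y = min 1 (real n * infdist y (- U))" for n :: nat and y
  have g_lim: "(\<lambda>n. g n y) \<longlonglongrightarrow> indicator U y" for y
    unfolding g_def by (rule open_indicator_limit[OF U False])
  have g: "0 \<le> g n y" "g n y \<le> 1" for n y unfolding g_def by (auto simp: infdist_nonneg)
  have g_cont: "continuous_on UNIV (g n)" for n
    unfolding g_def by (intro continuous_intros)
  have [measurable]: "g n \<in> borel_measurable borel" for n
    using g_cont by (rule borel_measurable_continuous_onI)
  have lim1: "(\<lambda>n. \<integral>\<omega>. g n (?X \<omega>) \<partial>M) \<longlonglongrightarrow> (\<integral>\<omega>. indicator U (?X \<omega>) \<partial>M)"
    by (rule integral_dominated_convergence[where w = "\<lambda>_. 1"]) (auto simp: g g_lim)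
  have "(\<lambda>n. \<integral>\<omega>. (g n (?B \<omega>))\<^sup>2 \<partial>M) \<longlonglongrightarrow> (\<integral>\<omega>. (indicator U (?B \<omega>))\<^sup>2 \<partial>M)"
    by (rule integral_dominated_convergence[where w = "\<lambda>_. 1"])
      (auto simp: g power_le_one intro!: tendsto_power g_lim)
  then have lim2: "(\<lambda>n. exp (C\<^sup>2 * T / 2) * sqrt (\<integral>\<omega>. (g n (?B \<omega>))\<^sup>2 \<partial>M))
    \<longlonglongrightarrow> exp (C\<^sup>2 * T / 2) * sqrt (\<integral>\<omega>. (indicator U (?B \<omega>))\<^sup>2 \<partial>M)"
    by (intro tendsto_intros)
  have bd: "(\<integral>\<omega>. g n (?X \<omega>) \<partial>M) \<le> exp (C\<^sup>2 * T / 2) * sqrt (\<integral>\<omega>. (g n (?B \<omega>))\<^sup>2 \<partial>M)" for n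
    by (rule continuous_bound[OF g_cont g t])
  have "(\<integral>\<omega>. indicator U (?X \<omega>) \<partial>M) \<le> exp (C\<^sup>2 * T / 2) * sqrt (\<integral>\<omega>. (indicator U (?B \<omega>))\<^sup>2 \<partial>M)"
    using bd by (intro LIMSEQ_le[OF lim1 lim2] exI allI impI)
  moreover have "(\<integral>\<omega>. indicator U (?X \<omega>) \<partial>M) = measure (distr M borel ?X) U"
    using integral_distr[OF X, of "indicator U :: _ \<Rightarrow> real"] by simp
  \<comment> \<open>Squaring leaves an indicator unchanged, so the second moment is the measure of
    \<open>U\<close>.\<close>
  moreover have "(indicator U y :: real)\<^sup>2 = indicator U y" for y
    by (auto simp: indicator_def)
  then have "(\<integral>\<omega>. (indicator U (?B \<omega>))\<^sup>2 \<partial>M) = measure (distr M borel ?B) U"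
    using integral_distr[OF B, of "indicator U :: _ \<Rightarrow> real"] by simp
  ultimately show ?thesis by simp
qed

text \<open>By outer regularity of finite Borel measures on the Polish space of sequences, a null
  set for the law of \<open>x + W\<close> lies in open sets of arbitrarily small mass, and to these
  \<open>open_bound\<close> applies.\<close>

lemma law_absolutely_continuous:
  fixes t :: "nat \<Rightarrow> real"
  assumes t: "\<And>i. t i \<in> {0..T}"
  shows "absolutely_continuous (distr M borel (\<lambda>\<omega> i. x + W (t i) \<omega>))
    (distr M borel (\<lambda>\<omega> i. x + D (t i) \<omega> + W (t i) \<omega>))"
proof -
  have [measurable]: "D (t i) \<in> borel_measurable M" "W (t i) \<in> borel_measurable M" for i
    using D_measurable[OF t] W_measurable t[of i] by auto
  define \<mu> where "\<mu> = distr M borel (\<lambda>\<omega> i. x + D (t i) \<omega> + W (t i) \<omega>)"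
  define \<nu> where "\<nu> = distr M borel (\<lambda>\<omega> i. x + W (t i) \<omega>)"
  interpret \<mu>: prob_space \<mu> unfolding \<mu>_def
    by (intro prob_space_distr measurable_coordinatewise_then_product) measurable
  interpret \<nu>: prob_space \<nu> unfolding \<nu>_def
    by (intro prob_space_distr measurable_coordinatewise_then_product) measurable
  have "A \<in> null_sets \<mu>" if A: "A \<in> null_sets \<nu>" for A
  proof -
    have A_borel: "A \<in> sets borel" using A by (auto simp: \<nu>_def)
    define c where "c = exp (C\<^sup>2 * T / 2)"
    have c: "c > 0" by (simp add: c_def)
    have "measure \<mu> A \<le> c * e" if e: "e > 0" for e
    proof -
      have "(INF U \<in> {U. A \<subseteq> U \<and> open U}. emeasure \<nu> U) = 0"
        using outer_regular[of \<nu> A] A A_borel \<nu>.emeasure_finite by (auto simp: \<nu>_def dest!: null_setsD1)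
      \<comment> \<open>The mass is taken below the square of \<open>e\<close> because
        \<open>open_bound\<close> puts a root on it.\<close>
      also have "0 < ennreal (e\<^sup>2)" using e by simp
      finally obtain U where U: "A \<subseteq> U" "open U" "emeasure \<nu> U < ennreal (e\<^sup>2)"
        by (auto simp: Inf_less_iff)
      have U': "measure \<nu> U < e\<^sup>2"
        using U(3) by (simp add: \<nu>.emeasure_eq_measure ennreal_less_iff)
      have "measure \<mu> A \<le> measure \<mu> U"
        using U by (intro \<mu>.finite_measure_mono) (auto simp: \<mu>_def)
      also have "\<dots> \<le> c * sqrt (measure \<nu> U)"
        unfolding \<mu>_def \<nu>_def c_def by (rule open_bound[OF t U(2)])
      also have "\<dots> \<le> c * e"
        using U' e c by (intro mult_left_mono real_le_lsqrt) auto
      finally show ?thesis .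
    qed
    from this[of "e / c" for e] have "measure \<mu> A \<le> 0 + e" if "e > 0" for e
      using that c by simp
    then have "measure \<mu> A \<le> 0" by (rule field_le_epsilon)
    moreover have "sets \<mu> = sets borel" by (simp add: \<mu>_def)
    ultimately show ?thesis
      using A_borel by (simp add: null_sets_def \<mu>.emeasure_eq_measure measure_le_0_iff)
  qed
  then show ?thesis unfolding absolutely_continuous_def \<mu>_def \<nu>_def by blast
qed

end

section \<open>Absolute continuity of image measures\<close>

lemma absolutely_continuous_distr:
  assumes "absolutely_continuous M N" and sets: "sets N = sets M" and f: "f \<in> measurable M K"
  shows "absolutely_continuous (distr M K f) (distr N K f)"
  unfolding absolutely_continuous_def
proof
  have sp: "space N = space M" and f': "f \<in> measurable N K"
    using sets_eq_imp_space_eq[OF sets] f measurable_cong_sets[OF sets refl, of K] by auto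
  fix A assume "A \<in> null_sets (distr M K f)"
  then have A: "A \<in> sets K" "f -` A \<inter> space M \<in> null_sets M"
    using f by (auto simp: null_sets_def emeasure_distr)
  then have "f -` A \<inter> space N \<in> null_sets N"
    using assms(1) by (auto simp: absolutely_continuous_def sp)
  then show "A \<in> null_sets (distr N K f)"
    using A(1) f' by (auto simp: null_sets_def emeasure_distr)
qed

section \<open>Independence after augmentation by null sets\<close>

text \<open>Sets agreeing outside a null set with one from the sigma-algebra of \<open>G\<close> are
  closed under complements and countable unions, and include \<open>G\<close> and all subsets of
  null sets.\<close>

lemma sigma_sets_mod_null:
  assumes "A \<in> sigma_sets (space M) (G \<union> null_subsets M)" and G: "G \<subseteq> sets M"
  shows "\<exists>A'\<in>sigma_sets (space M) G. \<exists>N\<in>null_sets M. sym_diff A A' \<subseteq> N"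
  using assms(1)
proof induction
  case (Basic A)
  then show ?case
  proof
    assume "A \<in> G"
    then show ?thesis by (intro bexI[of _ A] bexI[of _ "{}"] sigma_sets.Basic) auto
  next
    assume "A \<in> null_subsets M"
    then obtain N where "N \<in> null_sets M" "A \<subseteq> N" unfolding null_subsets_def by blast
    then show ?thesis by (intro bexI[of _ "{}"] bexI[of _ N] sigma_sets.Empty) auto
  qed
next
  case Empty
  show ?case by (intro bexI[of _ "{}"] sigma_sets.Empty) auto
next
  case (Compl A)
  then obtain A' N where *: "A' \<in> sigma_sets (space M) G" "N \<in> null_sets M" "sym_diff A A' \<subseteq> N"
    by (elim bexE)
  have "sym_diff (space M - A) (space M - A') \<subseteq> N" using *(3) by blast
  with * show ?case
    by (intro bexI[of _ "space M - A'"] bexI[of _ N] sigma_sets.Compl)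
next
  case (Union A)
  have "\<forall>i. \<exists>A'. A' \<in> sigma_sets (space M) G \<and> (\<exists>N\<in>null_sets M. sym_diff (A i) A' \<subseteq> N)"
    using Union.IH unfolding Bex_def by (rule allI)
  from choice[OF this] obtain A' where
    A': "\<forall>i. A' i \<in> sigma_sets (space M) G \<and> (\<exists>N\<in>null_sets M. sym_diff (A i) (A' i) \<subseteq> N)" ..
  then have "\<forall>i. \<exists>N. N \<in> null_sets M \<and> sym_diff (A i) (A' i) \<subseteq> N" by (simp add: Bex_def)
  from choice[OF this] obtain N where N: "\<forall>i. N i \<in> null_sets M \<and> sym_diff (A i) (A' i) \<subseteq> N i" ..
  show ?case
  proof (intro bexI)
    show "sym_diff (\<Union>i. A i) (\<Union>i. A' i) \<subseteq> (\<Union>i. N i)" using N by fast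
    show "(\<Union>i. N i) \<in> null_sets M" using N by (intro null_sets_UN) simp
    show "(\<Union>i. A' i) \<in> sigma_sets (space M) G" using A' by (intro sigma_sets.Union) simp
  qed
qed

text \<open>Probabilities do not see null sets, so a set of the augmented sigma-algebra can be
  exchanged for its unaugmented version. Completeness of \<open>M\<close> makes the added sets
  measurable.\<close>

lemma (in prob_space) indep_set_augment:
  assumes complete: "complete_space_measure M" and G: "G \<subseteq> sets M"
    and indep: "indep_set (sigma_sets (space M) G) H"
  shows "indep_set (sigma_sets (space M) (G \<union> null_subsets M)) H"
proof -
  have G': "sigma_sets (space M) G \<subseteq> sets M" "sigma_sets (space M) (G \<union> null_subsets M) \<subseteq> sets M"
    using G complete by (auto simp: complete_space_measure_def intro!: sets.sigma_sets_subset)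
  have H: "H \<subseteq> sets M" using indep by (auto simp: indep_set_def indep_sets_def split: bool.splits)
  show ?thesis
  proof (rule indep_setI)
    fix A B assume A: "A \<in> sigma_sets (space M) (G \<union> null_subsets M)" and B: "B \<in> H"
    obtain A' N where A': "A' \<in> sigma_sets (space M) G" "N \<in> null_sets M" "sym_diff A A' \<subseteq> N"
      using sigma_sets_mod_null[OF A G] by blast
    have ae: "AE \<omega> in M. \<omega> \<in> A \<longleftrightarrow> \<omega> \<in> A'"
      using A' by (intro AE_I'[of N]) auto
    have m: "A \<in> sets M" "A' \<in> sets M" "B \<in> sets M" using A A'(1) B G' H by auto
    have "prob (A \<inter> B) = prob (A' \<inter> B)"
      using ae m by (intro finite_measure_eq_AE) auto
    also have "\<dots> = prob A' * prob B" by (rule indep_setD[OF indep A'(1) B])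
    also have "prob A' = prob A"
      using ae m by (intro finite_measure_eq_AE) auto
    finally show "prob (A \<inter> B) = prob A * prob B" .
  qed (use G' H in auto)
qed

section \<open>Marginals of Brownian motion\<close>

text \<open>Induction adding a latest time \<open>b\<close>: given the past, the new coordinate is a
  translated nondegenerate Gaussian, which charges no Lebesgue null set, and Fubini reduces a null
  set to its slices. Time \<open>0\<close> is excluded because \<open>x + W 0\<close> is a point
  mass.\<close>

lemma (in filtered_bm) marginal_absolutely_continuous:
  assumes "finite J" "J \<subseteq> {0<..}"
  shows "absolutely_continuous (\<Pi>\<^sub>M j\<in>J. lborel)
    (distr M (\<Pi>\<^sub>M j\<in>J. lborel) (\<lambda>\<omega>. \<lambda>j\<in>J. x + W j \<omega>))"
  using assms
proof (induction J rule: finite_linorder_max_induct)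
  case empty
  then show ?case
    by (auto simp: absolutely_continuous_def PiM_empty null_sets_count_space)
next
  case (insert b J)
  interpret P: product_sigma_finite "\<lambda>_ :: real. lborel :: real measure"
    by standard
  note J = insert.hyps(1) and less = insert.hyps(2)
  \<comment> \<open>The latest earlier time, or \<open>0\<close> if there is none; positivity of the
    times gives \<open>s < b\<close> in the second case.\<close>
  define s where "s = (if J = {} then 0 else Max J)"
  have le_s: "j \<le> s" if "j \<in> J" for j
    using that J by (auto simp: s_def)
  have "0 \<le> s \<and> s < b"
  proof (cases "J = {}")
    case False
    then have "Max J \<in> J" using J by simp
    then have "0 < Max J" "Max J < b" using less insert.prems by auto
    with False show ?thesis unfolding s_def by auto
  qed (use insert.prems in \<open>auto simp: s_def\<close>)
  then have s: "0 \<le> s" "s < b" by auto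
  have b: "b \<notin> J" using less by auto
  let ?PJ = "\<Pi>\<^sub>M j\<in>J. (lborel :: real measure)" and ?PI = "\<Pi>\<^sub>M j\<in>insert b J. (lborel :: real measure)"
  let ?\<eta> = "\<lambda>\<omega>. \<lambda>j\<in>J. x + W j \<omega>" and ?\<xi> = "\<lambda>\<omega>. \<lambda>j\<in>insert b J. x + W j \<omega>"
  have \<eta>: "?\<eta> \<in> measurable (F s) ?PJ"
  proof (rule measurable_restrict)
    fix j assume j: "j \<in> J"
    then have "W j \<in> borel_measurable (F s)"
      using insert.prems le_s by (intro measurable_F_mono[OF _ _ W_adapted]) auto
    then show "(\<lambda>\<omega>. x + W j \<omega>) \<in> measurable (F s) lborel" by simp
  qed
  have \<xi>: "?\<xi> \<in> measurable M ?PI"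
  proof (rule measurable_restrict)
    fix j assume j: "j \<in> insert b J"
    then have "W j \<in> borel_measurable M"
      using insert.prems by (intro W_measurable) auto
    then show "(\<lambda>\<omega>. x + W j \<omega>) \<in> measurable M lborel" by simp
  qed
  show ?case
    unfolding absolutely_continuous_def
  proof
    fix A assume A_null: "A \<in> null_sets ?PI"
    then have A[measurable]: "A \<in> sets ?PI" by auto
    have upd: "(\<lambda>(v, y). v(b := y)) \<in> measurable (?PJ \<Otimes>\<^sub>M lborel) ?PI"
      by (rule measurable_add_dim)
    have slice_meas: "(\<lambda>(v, y). indicator A (v(b := y)) :: real) \<in> borel_measurable (?PJ \<Otimes>\<^sub>M borel)"
    proof -
      have "(indicator A :: _ \<Rightarrow> real) \<in> borel_measurable ?PI" using A by simp
      from measurable_compose[OF upd this] show ?thesis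
        by (simp only: split_beta' measurable_cong_sets[OF sets_pair_measure_cong[OF refl sets_lborel] refl])
    qed
    \<comment> \<open>By Tonelli, almost every slice of \<open>A\<close> in direction
      \<open>b\<close> is a null set.\<close>
    have "(\<integral>\<^sup>+ v. (\<integral>\<^sup>+ y. indicator A (v(b := y)) \<partial>lborel) \<partial>?PJ) = 0"
      using P.product_nn_integral_insert[OF J b, of "indicator A"] A_null by auto
    moreover have "(\<lambda>v. \<integral>\<^sup>+ y. indicator A (v(b := y)) \<partial>lborel) \<in> borel_measurable ?PJ"
    proof -
      have "(indicator A :: _ \<Rightarrow> ennreal) \<in> borel_measurable ?PI" using A by simp
      from measurable_compose[OF upd this] show ?thesis
        by (intro lborel.borel_measurable_nn_integral) (simp only: split_beta')
    qed
    ultimately have "AE v in ?PJ. (\<integral>\<^sup>+ y. indicator A (v(b := y)) \<partial>lborel) = 0"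
      by (simp add: nn_integral_0_iff_AE)
    \<comment> \<open>The induction hypothesis turns Lebesgue-almost every slice into almost every
      slice under the law of the earlier marginal.\<close>
    then have "AE v in distr M ?PJ ?\<eta>. (\<integral>\<^sup>+ y. indicator A (v(b := y)) \<partial>lborel) = 0"
      by (rule absolutely_continuous_AE[OF sets_distr insert.IH, rotated]) (use insert.prems in simp)
    then have slice_null: "AE \<omega> in M. (\<integral>\<^sup>+ y. indicator A ((?\<eta> \<omega>)(b := y)) \<partial>lborel) = 0"
      by (rule AE_distrD[OF measurable_F[OF s(1) \<eta>]])
    have "measure M (?\<xi> -` A \<inter> space M) = measure (distr M ?PI ?\<xi>) A"
      using \<xi> A by (simp add: measure_distr)
    also have "\<dots> = (\<integral>\<omega>. indicator A (?\<xi> \<omega>) \<partial>M)"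
      using integral_distr[OF \<xi>, of "indicator A :: _ \<Rightarrow> real"] A by simp
    \<comment> \<open>The new coordinate is \<open>x + W s\<close> plus the increment.
      \<open>W s\<close> is listed separately, since it is no coordinate of \<open>?\<eta>\<close>
      when \<open>J\<close> is empty.\<close>
    also have "\<dots> = (\<integral>\<omega>. (\<lambda>(v, c) u. indicator A (v(b := x + c + u))) (?\<eta> \<omega>, W s \<omega>) (W b \<omega> - W s \<omega>) \<partial>M)"
    proof (intro Bochner_Integration.integral_cong refl)
      fix \<omega>
      have "?\<xi> \<omega> = (?\<eta> \<omega>)(b := x + W s \<omega> + (W b \<omega> - W s \<omega>))"
        by (auto simp: fun_eq_iff)
      then show "indicator A (?\<xi> \<omega>)
        = (\<lambda>(v, c) u. indicator A (v(b := x + c + u)) :: real) (?\<eta> \<omega>, W s \<omega>) (W b \<omega> - W s \<omega>)"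
        by simp
    qed
    also have "\<dots> = (\<integral>\<omega>. (\<integral>u. (\<lambda>(v, c) u. indicator A (v(b := x + c + u)) :: real) (?\<eta> \<omega>, W s \<omega>) u
      \<partial>density lborel (normal_density 0 (sqrt (b - s)))) \<partial>M)"
    proof (rule integral_increment[OF s])
      show "(\<lambda>\<omega>. (?\<eta> \<omega>, W s \<omega>)) \<in> measurable (F s) (?PJ \<Otimes>\<^sub>M borel)"
        using \<eta> W_adapted[OF s(1)] by measurable
      have "(\<lambda>p. (fst (fst p), x + snd (fst p) + snd p)) \<in>
        measurable ((?PJ \<Otimes>\<^sub>M borel) \<Otimes>\<^sub>M borel) (?PJ \<Otimes>\<^sub>M borel)"
        by measurable
      from measurable_compose[OF this slice_meas]
      show "(\<lambda>((v, c), u). indicator A (v(b := x + c + u)) :: real) \<in> borel_measurable ((?PJ \<Otimes>\<^sub>M borel) \<Otimes>\<^sub>M borel)"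
        by (simp add: split_beta' del: fun_upd_apply)
      show "\<bar>(case v of (v, c) \<Rightarrow> \<lambda>u. indicator A (v(b := x + c + u)) :: real) u\<bar> \<le> 1" for v u
        by (auto split: prod.split simp: indicator_def)
    qed
    also have "\<dots> = 0"
    proof (rule integral_eq_zero_AE)
      show "AE \<omega> in M. (\<integral>u. (\<lambda>(v, c) u. indicator A (v(b := x + c + u)) :: real) (?\<eta> \<omega>, W s \<omega>) u
        \<partial>density lborel (normal_density 0 (sqrt (b - s)))) = 0"
        using slice_null AE_space
      proof eventually_elim
        case (elim \<omega>)
        let ?v = "?\<eta> \<omega>"
        have v: "?v \<in> space ?PJ" by (simp add: space_PiM)
        have m: "(\<lambda>y. indicator A (?v(b := y)) :: ennreal) \<in> borel_measurable lborel"
        proof -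
          have "(indicator A :: _ \<Rightarrow> ennreal) \<in> borel_measurable ?PI" using A by simp
          from measurable_Pair2[OF measurable_compose[OF upd this] v] show ?thesis by simp
        qed
        have ae: "AE y in lborel. ?v(b := y) \<notin> A"
          using elim(1) m by (simp add: nn_integral_0_iff_AE indicator_eq_0_iff del: fun_upd_apply)
        have "(\<lambda>y. ?v(b := y)) \<in> measurable borel ?PI"
          using measurable_Pair2[OF upd v] by simp
        from pred_sets2[OF A this] have "Measurable.pred borel (\<lambda>y. ?v(b := y) \<notin> A)"
          by (rule pred_intros_logic)
        \<comment> \<open>Translation by \<open>x + W s \<omega>\<close> preserves Lebesgue null
          sets, and the Gaussian has a density.\<close>
        from AE_borel_affine[OF _ this ae, of 1 "x + W s \<omega>"]
        have "AE u in lborel. ?v(b := x + W s \<omega> + u) \<notin> A"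
          by (simp del: fun_upd_apply)
        then have "AE u in density lborel (normal_density 0 (sqrt (b - s))). ?v(b := x + W s \<omega> + u) \<notin> A"
          by (subst AE_density) (auto simp del: fun_upd_apply elim!: eventually_mono)
        then have "AE u in density lborel (normal_density 0 (sqrt (b - s))).
            (indicator A (?v(b := x + W s \<omega> + u)) :: real) = 0"
          by eventually_elim simp
        then show ?case
          unfolding prod.case by (rule integral_eq_zero_AE)
      qed
    qed
    finally have "measure M (?\<xi> -` A \<inter> space M) = 0" .
    then show "A \<in> null_sets (distr M ?PI ?\<xi>)"
      using \<xi> A by (simp add: null_sets_def emeasure_distr emeasure_eq_measure)
  qed
qed

section \<open>The augmented Brownian filtration\<close>

lemma natural_sets_subset:
  assumes "\<And>s. 0 \<le> s \<Longrightarrow> s \<le> t \<Longrightarrow> W s \<in> borel_measurable M"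
  shows "natural_sets M W t \<subseteq> sets M"
  using measurable_sets[OF assms] by (auto simp: natural_sets_def)

lemma sets_aug_nat_filtration:
  "sets (aug_nat_filtration M W t) = sigma_sets (space M) (natural_sets M W t \<union> null_subsets M)"
  unfolding aug_nat_filtration_def
  by (rule sets_measure_of) (auto simp: natural_sets_def null_subsets_def dest: sets.sets_into_space)

text \<open>Completeness keeps the augmented sigma-algebras inside \<open>sets M\<close>, and
  \<open>indep_set_augment\<close> carries the independence of increments over from the natural
  filtration.\<close>

lemma brownian_motion_filtered:
  assumes complete: "complete_space_measure M" and BM: "brownian_motion M W"
  shows "filtered_bm M (aug_nat_filtration M W) W"
proof -
  interpret prob_space M using BM by (simp add: brownian_motion_def)
  have W: "\<And>t. 0 \<le> t \<Longrightarrow> W t \<in> borel_measurable M" using BM by (simp add: brownian_motion_def)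
  have nat: "natural_sets M W t \<subseteq> sets M" for t
    using W by (intro natural_sets_subset) auto
  note sets_F = sets_aug_nat_filtration[of M W]
  show ?thesis
  proof
    show sp: "space (aug_nat_filtration M W t) = space M" for t
      by (simp add: aug_nat_filtration_def space_measure_of_conv)
    show "sets (aug_nat_filtration M W t) \<subseteq> sets M" if "0 \<le> t" for t
      using nat complete unfolding sets_F complete_space_measure_def
      by (intro sets.sigma_sets_subset) auto
    show "sets (aug_nat_filtration M W s) \<subseteq> sets (aug_nat_filtration M W t)" if "0 \<le> s" "s \<le> t" for s t
      using that unfolding sets_F by (intro sigma_sets_mono') (force simp: natural_sets_def)
    show "W t \<in> borel_measurable (aug_nat_filtration M W t)" if t: "0 \<le> t" for t
    proof (rule measurableI)
      fix B :: "real set" assume "B \<in> sets borel"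
      then have "W t -` B \<inter> space M \<in> natural_sets M W t"
        using t unfolding natural_sets_def by (intro UN_I[of t]) auto
      then show "W t -` B \<inter> space (aug_nat_filtration M W t) \<in> sets (aug_nat_filtration M W t)"
        unfolding sets_F sp by (intro sigma_sets.Basic) auto
    qed simp
    show "W 0 \<omega> = 0" "continuous_on {0..} (\<lambda>t. W t \<omega>)" if "\<omega> \<in> space M" for \<omega>
      using BM that by (auto simp: brownian_motion_def)
    fix s t :: real assume st: "0 \<le> s" "s < t"
    show "distributed M lborel (\<lambda>\<omega>. W t \<omega> - W s \<omega>) (normal_density 0 (sqrt (t - s)))"
      using BM st by (simp add: brownian_motion_def)
    show "indep_set (sets (aug_nat_filtration M W s))
      (sigma_sets (space M) {(\<lambda>\<omega>. W t \<omega> - W s \<omega>) -` B \<inter> space M | B. B \<in> sets borel})"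
      unfolding sets_F
      by (rule indep_set_augment[OF complete nat]) (use BM st in \<open>simp add: brownian_motion_def\<close>)
  qed
qed

section \<open>Absolute continuity for the forward-backward system\<close>

text \<open>For \<open>s \<le> t\<close> the integrals differ by one over \<open>{s<..t}\<close>.
  This turns a bound on the drift coefficient into the Lipschitz bound on \<open>D\<close>.\<close>

lemma integral_Icc_lipschitz:
  fixes \<beta> :: "real \<Rightarrow> real"
  assumes int: "\<And>t. t \<in> {0..T} \<Longrightarrow> set_integrable lborel {0..t} \<beta>"
    and bd: "\<And>r. r \<in> {0..T} \<Longrightarrow> \<bar>\<beta> r\<bar> \<le> L"
    and st: "s \<in> {0..T}" "t \<in> {0..T}"
  shows "\<bar>(LINT r:{0..t}|lborel. \<beta> r) - (LINT r:{0..s}|lborel. \<beta> r)\<bar> \<le> L * \<bar>t - s\<bar>"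
proof -
  have *: "\<bar>(LINT r:{0..t}|lborel. \<beta> r) - (LINT r:{0..s}|lborel. \<beta> r)\<bar> \<le> L * (t - s)"
    if st: "s \<in> {0..T}" "t \<in> {0..T}" and le: "s \<le> t" for s t
  proof -
    have i: "integrable lborel (\<lambda>r. indicator {0..t} r * \<beta> r)" "integrable lborel (\<lambda>r. indicator {0..s} r * \<beta> r)"
      using int st by (auto simp: set_integrable_def)
    have "(LINT r:{0..t}|lborel. \<beta> r) - (LINT r:{0..s}|lborel. \<beta> r)
      = (\<integral>r. indicator {0..t} r * \<beta> r - indicator {0..s} r * \<beta> r \<partial>lborel)"
      unfolding set_lebesgue_integral_def using i by simp
    also have "\<bar>\<dots>\<bar> \<le> (\<integral>r. L * indicator {s<..t} r \<partial>lborel)"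
    proof (rule integral_abs_bound_integral)
      show "integrable lborel (\<lambda>r. indicator {0..t} r * \<beta> r - indicator {0..s} r * \<beta> r)"
        using i by simp
      show "integrable lborel (\<lambda>r. L * indicator {s<..t} r)"
        using le by (intro integrable_mult_right) simp
      show "\<bar>indicator {0..t} r * \<beta> r - indicator {0..s} r * \<beta> r\<bar> \<le> L * indicator {s<..t} r" for r
        using st le bd[of r] by (auto simp: indicator_def)
    qed
    also have "\<dots> = L * (t - s)" using le by simp
    finally show ?thesis .
  qed
  show ?thesis
    using *[OF st] *[OF st(2,1)] by (cases "s \<le> t") (auto simp: abs_minus_commute)
qed

theorem theorem5p26:
  fixes M :: "'a measure" and W :: "real \<Rightarrow> 'a \<Rightarrow> real"
    and b f :: "real \<Rightarrow> real \<Rightarrow> real \<Rightarrow> real \<Rightarrow> real"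
    and \<phi> \<l> :: "real \<Rightarrow> real"
    and T \<Lambda> K K\<^sub>0 \<beta> x :: real
    and X Y Z :: "real \<Rightarrow> 'a \<Rightarrow> real"
  assumes T_pos: "T > 0"
    and prob: "prob_space M"
    and complete: "complete_space_measure M"
    and BM: "brownian_motion M W"
    and b_meas: "(\<lambda>(t, x, y, z). b t x y z) \<in> borel_measurable (restrict_space borel ({0..T} \<times> UNIV))"
    and f_meas: "(\<lambda>(t, x, y, z). f t x y z) \<in> borel_measurable (restrict_space borel ({0..T} \<times> UNIV))"
    and \<phi>_meas: "\<phi> \<in> borel_measurable borel"
    and params: "\<Lambda> \<ge> 0" "K \<ge> 0" "K\<^sub>0 \<ge> 0" "0 < \<beta>" "\<beta> < 1"
    and \<l>_mono: "mono \<l>"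
    and \<l>_nonneg: "\<forall>u. \<l> u \<ge> 0"
    and \<l>_locbdd: "\<forall>a. bounded (\<l> ` {-a..a})"
    and \<l>_L1loc: "\<forall>a c. set_integrable lborel {a..c} \<l>"
    and b_bound: "\<forall>t\<in>{0..T}. \<forall>x y z. \<bar>b t x y z\<bar> \<le> \<Lambda> * (1 + \<bar>y\<bar>)"
    and b_lip: "\<forall>t\<in>{0..T}. \<forall>x y z y' z'.
                  \<bar>b t x y z - b t x y' z'\<bar> \<le> K * (\<bar>y - y'\<bar> + \<bar>z - z'\<bar>)"
    and f_bound: "\<forall>t\<in>{0..T}. \<forall>x y z. \<bar>f t x y z\<bar> \<le> \<Lambda> * (1 + \<bar>y\<bar> + \<l> y * \<bar>z\<bar>\<^sup>2)"
    and f_lip: "\<forall>t\<in>{0..T}. \<forall>x y z y' z'.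
                  \<bar>f t x y z - f t x y' z'\<bar>
                    \<le> K * (1 + \<l> (\<bar>y - y'\<bar>\<^sup>2) * (\<bar>z\<bar> + \<bar>z'\<bar>)) * (\<bar>y - y'\<bar> + \<bar>z - z'\<bar>)"
    and \<phi>_bound: "\<forall>x. \<bar>\<phi> x\<bar> \<le> \<Lambda>"
    and \<phi>_hoelder: "\<forall>x x'. \<bar>\<phi> x - \<phi> x'\<bar> \<le> K\<^sub>0 * \<bar>x - x'\<bar> powr \<beta>"
    and sol: "fbsde_solution M W (aug_nat_filtration M W) T b f \<phi> x X Y Z"
  shows "(\<forall>J. finite J \<and> J \<noteq> {} \<and> J \<subseteq> {0<..T} \<longrightarrow>
            absolutely_continuous (\<Pi>\<^sub>M j\<in>J. lborel)
              (distr M (\<Pi>\<^sub>M j\<in>J. lborel) (\<lambda>\<omega>. restrict (\<lambda>j. X j \<omega>) J)))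
       \<and> (\<forall>t\<in>{0<..T}. absolutely_continuous lborel (distr M lborel (X t)))"
proof -
  let ?F = "aug_nat_filtration M W"
  interpret filtered_bm M ?F W by (rule brownian_motion_filtered[OF complete BM])
  obtain C where C: "\<And>t \<omega>. t \<in> {0..T} \<Longrightarrow> \<omega> \<in> space M \<Longrightarrow> \<bar>Y t \<omega>\<bar> \<le> C"
    using sol unfolding fbsde_solution_def by blast
  have eq: "AE \<omega> in M. \<forall>t\<in>{0..T}. set_integrable lborel {0..t} (\<lambda>r. b r (X r \<omega>) (Y r \<omega>) (Z r \<omega>)) \<and>
      X t \<omega> = x + (LINT r:{0..t}|lborel. b r (X r \<omega>) (Y r \<omega>) (Z r \<omega>)) + W t \<omega>"
    using sol unfolding fbsde_solution_def by (auto elim: eventually_mono)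
  have X_adapted: "X t \<in> borel_measurable (?F t)" if "t \<in> {0..T}" for t
    using sol that unfolding fbsde_solution_def by blast
  define D where "D t \<omega> = X t \<omega> - x - W t \<omega>" for t \<omega>
  \<comment> \<open>The growth bound on \<open>b\<close> with \<open>Y\<close> bounded by
    \<open>C\<close>; the absolute value makes \<open>L\<close> nonnegative whatever the sign of
    \<open>C\<close>.\<close>
  define L where "L = \<Lambda> * (1 + \<bar>C\<bar>)"
  interpret lipschitz_drift M ?F W D T L
  proof
    show "0 < T" by (rule T_pos)
    show "0 \<le> L" using params by (simp add: L_def)
    show "D t \<in> borel_measurable (?F t)" if "t \<in> {0..T}" for t
    proof -
      have [measurable]: "X t \<in> borel_measurable (?F t)" "W t \<in> borel_measurable (?F t)"
        using X_adapted[OF that] W_adapted that by auto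
      show ?thesis unfolding D_def by measurable
    qed
    show "AE \<omega> in M. D 0 \<omega> = 0 \<and> (\<forall>s\<in>{0..T}. \<forall>t\<in>{0..T}. \<bar>D t \<omega> - D s \<omega>\<bar> \<le> L * \<bar>t - s\<bar>)"
      using eq AE_space
    proof eventually_elim
      case (elim \<omega>)
      let ?\<beta> = "\<lambda>r. b r (X r \<omega>) (Y r \<omega>) (Z r \<omega>)"
      have D: "D t \<omega> = (LINT r:{0..t}|lborel. ?\<beta> r)" if "t \<in> {0..T}" for t
        using elim(1) that by (auto simp: D_def)
      have \<beta>: "\<bar>?\<beta> r\<bar> \<le> L" if "r \<in> {0..T}" for r
      proof -
        have "\<bar>?\<beta> r\<bar> \<le> \<Lambda> * (1 + \<bar>Y r \<omega>\<bar>)" using b_bound that by blast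
        also have "\<dots> \<le> L"
          unfolding L_def using C[OF that elim(2)] params by (intro mult_left_mono) auto
        finally show ?thesis .
      qed
      \<comment> \<open>The interval degenerates to a null set, whence
        \<open>D 0 = 0\<close>.\<close>
      have "AE r in lborel. indicator {0..0::real} r *\<^sub>R ?\<beta> r = 0"
        using AE_lborel_singleton[of "0 :: real"] by eventually_elim simp
      then have "(LINT r:{0..0}|lborel. ?\<beta> r) = 0"
        unfolding set_lebesgue_integral_def by (rule integral_eq_zero_AE)
      then show ?case
        using integral_Icc_lipschitz[of T ?\<beta> L] elim(1) \<beta> D T_pos by auto
    qed
  qed
  have fdd: "absolutely_continuous (\<Pi>\<^sub>M j\<in>J. lborel)
      (distr M (\<Pi>\<^sub>M j\<in>J. lborel) (\<lambda>\<omega>. restrict (\<lambda>j. X j \<omega>) J))"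
    if J: "finite J" "J \<noteq> {}" "J \<subseteq> {0<..T}" for J
  proof -
    let ?P = "\<Pi>\<^sub>M j\<in>J. (lborel :: real measure)"
    \<comment> \<open>The finite set \<open>J\<close> is listed as an infinite sequence with
      repetitions, to fit the results on sequences; as \<open>J\<close> is nonempty, every entry
      lies in \<open>J\<close>. The map \<open>\<pi>\<close> reads each time of \<open>J\<close> off
      at its index.\<close>
    define t where "t = from_nat_into J"
    define \<pi> where "\<pi> y = (\<lambda>j\<in>J. y (to_nat_on J j))" for y :: "nat \<Rightarrow> real"
    have t: "t i \<in> {0..T}" for i
      using from_nat_into[OF J(2), of i] J(3) by (auto simp: t_def)
    have t_inv: "t (to_nat_on J j) = j" if "j \<in> J" for j
      using that J(1) by (simp add: t_def countable_finite)
    have \<pi>: "\<pi> \<in> measurable borel ?P"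
      unfolding \<pi>_def by (intro measurable_restrict) simp
    have [measurable]: "D (t i) \<in> borel_measurable M" "W (t i) \<in> borel_measurable M" for i
      using D_measurable[OF t] W_measurable t[of i] by auto
    have "(\<lambda>\<omega> i. x + D (t i) \<omega> + W (t i) \<omega>) \<in> borel_measurable M" "(\<lambda>\<omega> i. x + W (t i) \<omega>) \<in> borel_measurable M"
      by (intro measurable_coordinatewise_then_product; measurable)+
    then have "distr (distr M borel (\<lambda>\<omega> i. x + W (t i) \<omega>)) ?P \<pi> = distr M ?P (\<lambda>\<omega>. \<lambda>j\<in>J. x + W j \<omega>)"
      "distr (distr M borel (\<lambda>\<omega> i. x + D (t i) \<omega> + W (t i) \<omega>)) ?P \<pi> = distr M ?P (\<lambda>\<omega>. \<lambda>j\<in>J. X j \<omega>)"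
      using \<pi> by (auto simp: distr_distr comp_def \<pi>_def t_inv D_def cong: restrict_cong)
    moreover have "absolutely_continuous (distr (distr M borel (\<lambda>\<omega> i. x + W (t i) \<omega>)) ?P \<pi>)
        (distr (distr M borel (\<lambda>\<omega> i. x + D (t i) \<omega> + W (t i) \<omega>)) ?P \<pi>)"
      using \<pi> by (intro absolutely_continuous_distr law_absolutely_continuous t) auto
    moreover have "absolutely_continuous ?P (distr M ?P (\<lambda>\<omega>. \<lambda>j\<in>J. x + W j \<omega>))"
      using J by (intro marginal_absolutely_continuous) auto
    \<comment> \<open>Lebesgue measure dominates the law of \<open>x + W\<close>, which dominates
      that of \<open>X\<close>.\<close>
    ultimately show ?thesis
      unfolding absolutely_continuous_def by auto
  qed
  moreover have "absolutely_continuous lborel (distr M lborel (X t))" if t: "t \<in> {0<..T}" for t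
  proof -
    interpret P: product_sigma_finite "\<lambda>_ :: real. lborel :: real measure" by standard
    let ?P = "\<Pi>\<^sub>M j\<in>{t}. (lborel :: real measure)"
    have X_meas: "X t \<in> borel_measurable M"
      using measurable_F[OF _ X_adapted] t by simp
    then have "(\<lambda>\<omega>. \<lambda>j\<in>{t}. X j \<omega>) \<in> measurable M ?P"
      by (intro measurable_restrict) simp
    then have "distr (distr M ?P (\<lambda>\<omega>. \<lambda>j\<in>{t}. X j \<omega>)) lborel (\<lambda>v. v t) = distr M lborel (X t)"
      by (subst distr_distr) (auto simp: comp_def)
    \<comment> \<open>Evaluation at the only time identifies the product over \<open>{t}\<close>
      with the line, so the density of \<open>X t\<close> is the case
      \<open>J = {t}\<close>.\<close>
    moreover have "distr ?P lborel (\<lambda>v. v t) = lborel"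
      by (rule P.distr_singleton)
    moreover have "absolutely_continuous (distr ?P lborel (\<lambda>v. v t))
        (distr (distr M ?P (\<lambda>\<omega>. \<lambda>j\<in>{t}. X j \<omega>)) lborel (\<lambda>v. v t))"
      using t by (intro absolutely_continuous_distr fdd) auto
    ultimately show ?thesis by simp
  qed
  ultimately show ?thesis by blast
qed

end
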